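(* Let $\Sigma = \{0,1,2,3\}$. There is a finite set $F \subset \mathrm{Aut}(\Sigma^{\mathbb{Z}})$ such that each element of $F$ is a commutator of two elements of $\mathrm{Aut}(\Sigma^{\mathbb{Z}})$ and is also a composition of (finitely many) involutive (i.e. order two) elements of $\mathrm{Aut}(\Sigma^{\mathbb{Z}})$, and such that the group $\langle F \rangle$ generated by $F$ acts $\infty$-orbit-transitively on the set $X_0$ of nonzero finite points of $\Sigma^{\mathbb{Z}}$. That is, $g(X_0) \subset X_0$ for all $g \in \langle F\rangle$, and for every $k \ge 1$ and all $(x_1,\ldots,x_k), (y_1,\ldots,y_k) \in X_0^k$ such that $x_1,\ldots,x_k$ lie in pairwise different $\sigma$-orbits and $y_1,\ldots,y_k$ lie in pairwise different $\sigma$-orbits, there exists $g \in \langle F \rangle$ with $g(x_i) = y_i$ for all $i \in \{1,\ldots,k\}$.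
   Context: $\Sigma^{\mathbb{Z}}$ has the product topology ($\Sigma$ discrete), and the shift is $\sigma(x)_i = x_{i+1}$. $\mathrm{Aut}(\Sigma^{\mathbb{Z}})$ is the group, under composition, of homeomorphisms $f : \Sigma^{\mathbb{Z}} \to \Sigma^{\mathbb{Z}}$ commuting with $\sigma$. The commutator of $a,b$ is $[a,b] = a b a^{-1} b^{-1}$. The $\sigma$-orbit of $x$ is $\{\sigma^n(x) \mid n \in \mathbb{Z}\}$. A nonzero finite point is a point $x \in \Sigma^{\mathbb{Z}}$ whose support $\{i \mid x_i \neq 0\}$ is finite and nonempty. *)

theory Defs
  imports
    "HOL-Analysis.Function_Topology"
    "HOL-Library.Numeral_Type"
    "HOL-Algebra.Generated_Groups"
begin

type_synonym 'a config = "int \<Rightarrow> 'a"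

text \<open>
  The alphabet is the universe of a type \<^typ>\<open>'a\<close>. It is instantiated with the four-element
  type \<^typ>\<open>4\<close>, whose \<^const>\<open>UNIV\<close> is \<open>{0, 1, 2, 3}\<close>.
\<close>

lemma UNIV_4: "(UNIV :: 4 set) = {0, 1, 2, 3}"
proof -
  have d: "distinct [0, 1, 2, 3 :: 4]" by simp
  have "card {0, 1, 2, 3 :: 4} = card (UNIV :: 4 set)"
    using distinct_card[OF d] by simp
  then show ?thesis
    by (intro card_subset_eq[symmetric]) auto
qed

definition config_topology :: "'a config topology" where
  "config_topology = product_topology (\<lambda>_. discrete_topology UNIV) UNIV"

definition shift :: "'a config \<Rightarrow> 'a config" where
  "shift x = (\<lambda>i. x (i + 1))"

definition Aut :: "('a config \<Rightarrow> 'a config) monoid" where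
  "Aut = \<lparr>carrier = {f. homeomorphic_map config_topology config_topology f
                        \<and> f \<circ> shift = shift \<circ> f},
          mult = (\<circ>), one = id\<rparr>"

definition commutator :: "('g, 'b) monoid_scheme \<Rightarrow> 'g \<Rightarrow> 'g \<Rightarrow> 'g" where
  "commutator G a b = a \<otimes>\<^bsub>G\<^esub> b \<otimes>\<^bsub>G\<^esub> inv\<^bsub>G\<^esub> a \<otimes>\<^bsub>G\<^esub> inv\<^bsub>G\<^esub> b"

definition involutions :: "('g, 'b) monoid_scheme \<Rightarrow> 'g set" where
  "involutions G = {h \<in> carrier G. h \<noteq> \<one>\<^bsub>G\<^esub> \<and> h \<otimes>\<^bsub>G\<^esub> h = \<one>\<^bsub>G\<^esub>}"

definition shift_orbit :: "'a config \<Rightarrow> 'a config set" where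
  "shift_orbit x = {(shift [^]\<^bsub>Aut\<^esub> n) x | n :: int. True}"

definition nonzero_finite_points :: "'a::zero config set" where
  "nonzero_finite_points = {x. finite {i. x i \<noteq> 0} \<and> {i. x i \<noteq> 0} \<noteq> {}}"

definition inf_orbit_transitive :: "('a config \<Rightarrow> 'a config) set \<Rightarrow> 'a config set \<Rightarrow> bool" where
  "inf_orbit_transitive H X \<longleftrightarrow>
     (\<forall>g\<in>H. g ` X \<subseteq> X) \<and>
     (\<forall>k\<ge>1. \<forall>x y :: nat \<Rightarrow> 'a config.
        (\<forall>i\<in>{1..k}. x i \<in> X \<and> y i \<in> X) \<longrightarrow>
        (\<forall>i\<in>{1..k}. \<forall>j\<in>{1..k}. i \<noteq> j \<longrightarrow> shift_orbit (x i) \<noteq> shift_orbit (x j)) \<longrightarrow>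
        (\<forall>i\<in>{1..k}. \<forall>j\<in>{1..k}. i \<noteq> j \<longrightarrow> shift_orbit (y i) \<noteq> shift_orbit (y j)) \<longrightarrow>
        (\<exists>g\<in>H. \<forall>i\<in>{1..k}. g (x i) = y i))"

lemma topspace_config [simp]: "topspace config_topology = UNIV"
  by (simp add: config_topology_def)

lemma continuous_map_config_translate:
  "continuous_map config_topology config_topology (\<lambda>x i. x (i + c))"
  unfolding config_topology_def
  by (auto simp: continuous_map_componentwise_UNIV intro: continuous_map_product_projection)

lemma group_Aut: "group (Aut :: ('a config \<Rightarrow> 'a config) monoid)"
proof (rule groupI)
  fix f g :: "'a config \<Rightarrow> 'a config"
  assume f: "f \<in> carrier Aut" and g: "g \<in> carrier Aut"
  have "f (shift x) = shift (f x)" "g (shift x) = shift (g x)" for x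
    using f g by (simp_all add: Aut_def fun_eq_iff)
  then have "f \<circ> g \<circ> shift = shift \<circ> (f \<circ> g)"
    by (intro ext) simp
  with f g show "f \<otimes>\<^bsub>Aut\<^esub> g \<in> carrier Aut"
    by (auto simp: Aut_def intro: homeomorphic_map_compose)
next
  fix f :: "'a config \<Rightarrow> 'a config"
  assume f: "f \<in> carrier Aut"
  then obtain g where "homeomorphic_maps config_topology config_topology f g"
    by (auto simp: Aut_def homeomorphic_map_maps)
  then have g: "homeomorphic_map config_topology config_topology g"
      and fg: "\<And>x. f (g x) = x" and gf: "\<And>x. g (f x) = x"
    by (auto simp: homeomorphic_maps_map)
  have "f (shift x) = shift (f x)" for x
    using f by (auto simp: Aut_def fun_eq_iff)
  then have "g (shift x) = shift (g x)" for x
    by (metis fg gf)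
  then show "\<exists>g\<in>carrier Aut. g \<otimes>\<^bsub>Aut\<^esub> f = \<one>\<^bsub>Aut\<^esub>"
    using g gf by (intro bexI[of _ g]) (auto simp: Aut_def)
qed (auto simp: Aut_def comp_assoc)

lemma translate_in_Aut: "(\<lambda>x i. x (i + c)) \<in> carrier Aut"
proof -
  have "homeomorphic_maps config_topology config_topology (\<lambda>x i. x (i + c)) (\<lambda>x i. x (i + (- c)))"
    unfolding homeomorphic_maps_def
    using continuous_map_config_translate[of c] continuous_map_config_translate[of "- c"] by auto
  then show ?thesis
    by (auto simp: Aut_def homeomorphic_map_maps shift_def fun_eq_iff algebra_simps)
qed

lemma shift_int_pow: "(shift [^]\<^bsub>Aut\<^esub> (n :: int)) x = (\<lambda>i. x (i + n))"
proof -
  interpret group "Aut :: ('a config \<Rightarrow> 'a config) monoid" by (rule group_Aut)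
  have nat: "(shift [^]\<^bsub>Aut\<^esub> m) = (\<lambda>(x :: 'a config) i. x (i + int m))" for m :: nat
    by (induction m) (auto simp: Aut_def shift_def fun_eq_iff algebra_simps)
  have inv: "inv\<^bsub>Aut\<^esub> (\<lambda>(x :: 'a config) i. x (i + c)) = (\<lambda>x i. x (i + (- c)))" for c
    by (rule inv_equality[OF _ translate_in_Aut translate_in_Aut]) (auto simp: Aut_def fun_eq_iff)
  then show ?thesis
    using inv[of "- n"] by (simp add: int_pow_def2 nat)
qed

end

(*
  Identify the alphabet with pairs of bits, so that a configuration is a pair (t, b) of binary
  tracks. If r is an involution, then [a, r] = (a r a^-1) r is both a commutator and a product of
  two involutions; all generators have this form. They are: the shift of the two tracks in opposite
  directions; gates adding to b a pair of adjacent bits ("pulse") at every position where t has a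
  1 preceded by 0000; and gates permuting the two bits x, y of every isolated word 00 1xy 00 of b,
  namely a 3-cycle, and a transposition controlled by t(i) \<noteq> t(i+1); together with the same gates
  with the two tracks exchanged.

  Since [3-cycle if P, transposition if Q] = (inverse 3-cycle if P and Q), the 3-cycle can be
  controlled by arbitrarily many bits of t. Conjugating it by a pulse gate adds a single bit to b at
  a chosen place n, provided b is zero around n, exactly for the points whose track t lies in a
  prescribed orbit. Such additions first make all the tracks t, and all the tracks b, pairwise
  shift-inequivalent. Then any track b_j can be replaced alone: put a far away bit on t_j, which is
  detected through b_j, let it act through pulse gates, and remove it again. This changes b_j by any
  finite set of even size; the parity is corrected by adding a far away bit to b_j itself.
*)
theory Submission
  imports Defs
begin

section \<open>Pairs of tracks and their automorphisms\<close>

type_synonym track = "int \<Rightarrow> bool"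

text \<open>A positive \<open>q\<close> moves the pattern to the right, so \<open>shift\<close>
  corresponds to \<open>translate (-1)\<close>.\<close>

definition translate :: "int \<Rightarrow> track \<Rightarrow> track" where
  "translate q t = (\<lambda>i. t (i - q))"

definition xor_track :: "track \<Rightarrow> track \<Rightarrow> track" (infixl \<open>\<oplus>\<oplus>\<close> 65) where
  "a \<oplus>\<oplus> b = (\<lambda>i. a i \<noteq> b i)"

definition finite_track :: "track \<Rightarrow> bool" where
  "finite_track t \<longleftrightarrow> finite {i. t i}"

definition nonzero_track :: "track \<Rightarrow> bool" where
  "nonzero_track t \<longleftrightarrow> (\<exists>i. t i)"

text \<open>Letter 0 encodes two false bits, so that the support of a configuration is the union of
  the supports of its two tracks.\<close>

definition symbol :: "bool \<Rightarrow> bool \<Rightarrow> 4" where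
  "symbol u v = (if u then if v then 3 else 1 else if v then 2 else 0)"

definition enc :: "track \<times> track \<Rightarrow> 4 config" where
  "enc x = (\<lambda>i. symbol (fst x i) (snd x i))"

definition dec :: "4 config \<Rightarrow> track \<times> track" where
  "dec x = (\<lambda>i. x i \<in> {1, 3}, \<lambda>i. x i \<in> {2, 3})"

lemma four_cases: obtains "(s :: 4) = 0" | "s = 1" | "s = 2" | "s = 3"
  using UNIV_4 by (metis UNIV_I insertE emptyE)

lemma dec_enc [simp]: "dec (enc x) = x"
  by (auto simp: dec_def enc_def symbol_def prod_eq_iff fun_eq_iff)

lemma enc_dec [simp]: "enc (dec x) = x"
proof
  fix i show "enc (dec x) i = x i"
    by (rule four_cases[of "x i"]) (simp_all add: enc_def dec_def symbol_def)
qed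

lemma symbol_eq_0_iff: "symbol u v = 0 \<longleftrightarrow> \<not> u \<and> \<not> v"
  by (simp add: symbol_def)

definition lift :: "(track \<times> track \<Rightarrow> track \<times> track) \<Rightarrow> 4 config \<Rightarrow> 4 config" where
  "lift f = enc \<circ> f \<circ> dec"

lemma lift_comp: "lift (f \<circ> g) = lift f \<circ> lift g"
  by (auto simp: lift_def)

lemma lift_id [simp]: "lift id = id"
  by (auto simp: lift_def)

lemma lift_inj: "lift f = lift g \<Longrightarrow> f = g"
  by (metis comp_apply dec_enc ext lift_def)

definition translate_pair :: "int \<Rightarrow> track \<times> track \<Rightarrow> track \<times> track" where
  "translate_pair q x = (translate q (fst x), translate q (snd x))"

definition finite_pair :: "track \<times> track \<Rightarrow> bool" where
  "finite_pair x \<longleftrightarrow> finite_track (fst x) \<and> finite_track (snd x)"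

definition nonzero_pair :: "track \<times> track \<Rightarrow> bool" where
  "nonzero_pair x \<longleftrightarrow> nonzero_track (fst x) \<or> nonzero_track (snd x)"

definition zero_pair :: "track \<times> track" where
  "zero_pair = (\<lambda>_. False, \<lambda>_. False)"

lemma nonzero_pair_iff: "nonzero_pair x \<longleftrightarrow> x \<noteq> zero_pair"
  by (auto simp: nonzero_pair_def nonzero_track_def zero_pair_def prod_eq_iff fun_eq_iff)

lemma enc_nonzero_finite_iff: "enc x \<in> nonzero_finite_points \<longleftrightarrow> finite_pair x \<and> nonzero_pair x"
proof -
  have "{i. enc x i \<noteq> 0} = {i. fst x i} \<union> {i. snd x i}"
    by (auto simp: enc_def symbol_eq_0_iff)
  then show ?thesis
    by (auto simp: nonzero_finite_points_def finite_pair_def nonzero_pair_def finite_track_def nonzero_track_def)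
qed

text \<open>The window condition of a block map of radius \<open>r\<close>; commuting with
  translations is kept apart in \<open>equivariant\<close>.\<close>

definition local_map :: "int \<Rightarrow> (track \<times> track \<Rightarrow> track \<times> track) \<Rightarrow> bool" where
  "local_map r f \<longleftrightarrow> (\<forall>x y i. (\<forall>j. \<bar>j - i\<bar> \<le> r \<longrightarrow> fst x j = fst y j \<and> snd x j = snd y j) \<longrightarrow>
     fst (f x) i = fst (f y) i \<and> snd (f x) i = snd (f y) i)"

lemma local_mapD:
  assumes "local_map r f" "\<And>j. \<bar>j - i\<bar> \<le> r \<Longrightarrow> fst x j = fst y j \<and> snd x j = snd y j"
  shows "fst (f x) i = fst (f y) i \<and> snd (f x) i = snd (f y) i"
  using assms unfolding local_map_def by blast

definition equivariant :: "(track \<times> track \<Rightarrow> track \<times> track) \<Rightarrow> bool" where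
  "equivariant f \<longleftrightarrow> (\<forall>q x. f (translate_pair q x) = translate_pair q (f x))"

text \<open>Finite pairs and \<open>zero_pair\<close> are recorded here because they make the set of
  nonzero finite points invariant.\<close>

definition automorphism :: "(track \<times> track \<Rightarrow> track \<times> track) \<Rightarrow> bool" where
  "automorphism f \<longleftrightarrow> lift f \<in> carrier Aut \<and> equivariant f \<and>
     (\<forall>x. finite_pair x \<longrightarrow> finite_pair (f x)) \<and> f zero_pair = zero_pair"

section \<open>Block maps as homeomorphisms\<close>

lemma openin_config_cylinder:
  fixes P :: "'a config \<Rightarrow> bool"
  assumes "finite J" and dep: "\<And>x y. (\<And>j. j \<in> J \<Longrightarrow> x j = y j) \<Longrightarrow> P x \<Longrightarrow> P y"
  shows "openin config_topology {x. P x}"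
proof -
  have cyl: "openin config_topology {y. y j = a}" for j and a :: 'a
  proof -
    have "continuous_map config_topology (discrete_topology UNIV) (\<lambda>x :: 'a config. x j)"
      unfolding config_topology_def by (auto intro: continuous_map_product_projection)
    then have "openin config_topology {x \<in> topspace config_topology. x j \<in> {a}}"
      by (rule openin_continuous_map_preimage) simp
    then show ?thesis by simp
  qed
  have "openin config_topology {y. \<forall>j\<in>J. y j = x j}" for x :: "'a config"
    using \<open>finite J\<close>
  proof induction
    case empty
    then show ?case using openin_topspace[of config_topology] by simp
  next
    case (insert j J)
    have "{y. \<forall>k\<in>insert j J. y k = x k} = {y. y j = x j} \<inter> {y. \<forall>k\<in>J. y k = x k}" by auto
    then show ?case using insert cyl by auto
  qed
  moreover have "{x. P x} = (\<Union>x\<in>{x. P x}. {y. \<forall>j\<in>J. y j = x j})"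
  proof (intro subset_antisym subsetI)
    fix y assume "y \<in> (\<Union>x\<in>{x. P x}. {y. \<forall>j\<in>J. y j = x j})"
    then obtain x where "P x" "\<forall>j\<in>J. y j = x j" by blast
    then show "y \<in> {x. P x}" using dep[of x y] by simp
  qed blast
  ultimately show ?thesis by (metis (mono_tags, lifting) imageE openin_Union)
qed

text \<open>Each output cell depends on the finitely many input cells in its window, so preimages
  under the coordinate maps are open. This is the easy half of the Curtis-Hedlund-Lyndon
  theorem.\<close>

lemma continuous_lift:
  assumes "local_map r f"
  shows "continuous_map config_topology config_topology (lift f)"
proof -
  have "continuous_map config_topology (discrete_topology UNIV) (\<lambda>x. lift f x i)" for i
    unfolding continuous_map_def
  proof (intro conjI allI impI)
    fix U :: "4 set"
    have "openin config_topology {x. lift f x i \<in> U}"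
    proof (rule openin_config_cylinder[of "{i - r..i + r}"])
      fix x y :: "4 config"
      assume xy: "\<And>j. j \<in> {i - r..i + r} \<Longrightarrow> x j = y j" and "lift f x i \<in> U"
      have "fst (f (dec x)) i = fst (f (dec y)) i \<and> snd (f (dec x)) i = snd (f (dec y)) i"
        using assms
      proof (rule local_mapD)
        fix j assume "\<bar>j - i\<bar> \<le> r"
        then have "x j = y j" by (intro xy) auto
        then show "fst (dec x) j = fst (dec y) j \<and> snd (dec x) j = snd (dec y) j"
          by (simp add: dec_def)
      qed
      then have "lift f x i = lift f y i" by (simp add: lift_def enc_def)
      with \<open>lift f x i \<in> U\<close> show "lift f y i \<in> U" by simp
    qed simp
    then show "openin config_topology {x \<in> topspace config_topology. lift f x i \<in> U}" by simp
  qed auto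
  then show ?thesis
    unfolding config_topology_def continuous_map_componentwise_UNIV by simp
qed

lemma shift_enc: "shift (enc x) = enc (translate_pair (-1) x)"
  by (simp add: shift_def enc_def translate_pair_def translate_def)

lemma dec_shift: "dec (shift x) = translate_pair (-1) (dec x)"
  by (metis dec_enc enc_dec shift_enc)

text \<open>Outside the \<open>r\<close>-neighbourhood of the support of \<open>x\<close>, the
  window of a cell shows only zeros, so \<open>f x\<close> agrees there with
  \<open>f zero_pair\<close>.\<close>

lemma local_map_finite_pair:
  assumes loc: "local_map r f" and f0: "f zero_pair = zero_pair" and x: "finite_pair x"
  shows "finite_pair (f x)"
proof -
  let ?S = "{i. fst x i} \<union> {i. snd x i}"
  let ?U = "\<Union>j\<in>?S. {j - r..j + r}"
  have U: "finite ?U" using x by (auto simp: finite_pair_def finite_track_def)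
  have "\<not> fst (f x) i \<and> \<not> snd (f x) i" if "i \<notin> ?U" for i
  proof -
    have "fst (f x) i = fst (f zero_pair) i \<and> snd (f x) i = snd (f zero_pair) i"
      using loc
    proof (rule local_mapD)
      fix j assume "\<bar>j - i\<bar> \<le> r"
      then have "i \<in> {j - r..j + r}" by auto
      then have "j \<notin> ?S" using that by blast
      then show "fst x j = fst zero_pair j \<and> snd x j = snd zero_pair j" by (simp add: zero_pair_def)
    qed
    then show ?thesis unfolding f0 by (simp add: zero_pair_def)
  qed
  then have "{i. fst (f x) i} \<subseteq> ?U" "{i. snd (f x) i} \<subseteq> ?U" by blast+
  then show ?thesis using U unfolding finite_pair_def finite_track_def by (meson finite_subset)
qed

lemma automorphismI:
  assumes "local_map r f" "local_map r f'" "equivariant f" "f zero_pair = zero_pair"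
    and inv: "\<And>x. f' (f x) = x" "\<And>x. f (f' x) = x"
  shows "automorphism f"
proof -
  have "homeomorphic_maps config_topology config_topology (lift f) (lift f')"
    unfolding homeomorphic_maps_def
    using continuous_lift[OF assms(1)] continuous_lift[OF assms(2)] inv by (simp add: lift_def)
  then have "homeomorphic_map config_topology config_topology (lift f)"
    using homeomorphic_map_maps by blast
  moreover have "lift f \<circ> shift = shift \<circ> lift f"
    using assms(3) by (simp add: fun_eq_iff[of "_ \<circ> _"] lift_def dec_shift shift_enc equivariant_def del: split_paired_All)
  ultimately show ?thesis
    using assms local_map_finite_pair[OF assms(1,4)] by (simp add: automorphism_def Aut_def)
qed

lemma mult_Aut [simp]: "f \<otimes>\<^bsub>Aut\<^esub> g = f \<circ> g"
  by (simp add: Aut_def)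

lemma one_Aut [simp]: "\<one>\<^bsub>Aut\<^esub> = id"
  by (simp add: Aut_def)

lemma automorphism_comp: "automorphism f \<Longrightarrow> automorphism g \<Longrightarrow> automorphism (f \<circ> g)"
  using group.is_monoid[OF group_Aut, THEN monoid.m_closed, of "lift f" "lift g"]
  by (simp add: automorphism_def equivariant_def lift_comp del: split_paired_All)

section \<open>Exchange of the tracks and involutive commutators\<close>

definition swapped :: "(track \<times> track \<Rightarrow> track \<times> track) \<Rightarrow> track \<times> track \<Rightarrow> track \<times> track" where
  "swapped f = prod.swap \<circ> f \<circ> prod.swap"

lemma swapped_comp: "swapped (f \<circ> g) = swapped f \<circ> swapped g"
  by (auto simp: swapped_def fun_eq_iff)

lemma swapped_id [simp]: "swapped id = id"
  by (auto simp: swapped_def fun_eq_iff)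

lemma swapped_swapped [simp]: "swapped (swapped f) = f"
  by (auto simp: swapped_def fun_eq_iff)

lemma automorphism_swap: "automorphism prod.swap"
proof (rule automorphismI[where r = 0 and f' = prod.swap])
  show "local_map 0 prod.swap" by (auto simp: local_map_def)
  then show "local_map 0 prod.swap" .
qed (auto simp: equivariant_def translate_pair_def zero_pair_def)

lemma automorphism_swapped: "automorphism f \<Longrightarrow> automorphism (swapped f)"
  unfolding swapped_def by (intro automorphism_comp automorphism_swap)

definition involutive_commutator :: "(track \<times> track \<Rightarrow> track \<times> track) \<Rightarrow> bool" where
  "involutive_commutator g \<longleftrightarrow> (\<exists>a a' r. automorphism a \<and> automorphism a' \<and>
     a \<circ> a' = id \<and> a' \<circ> a = id \<and> automorphism r \<and> r \<circ> r = id \<and> r \<noteq> id \<and>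
     g = a \<circ> r \<circ> a' \<circ> r)"

lemma involutive_commutator_swapped: "involutive_commutator g \<Longrightarrow> involutive_commutator (swapped g)"
  unfolding involutive_commutator_def
proof (elim exE conjE)
  fix a a' r
  assume *: "automorphism a" "automorphism a'" "a \<circ> a' = id" "a' \<circ> a = id" "automorphism r" "r \<circ> r = id" "r \<noteq> id"
    "g = a \<circ> r \<circ> a' \<circ> r"
  have "swapped r \<noteq> id" using \<open>r \<noteq> id\<close> by (metis swapped_id swapped_swapped)
  then show "\<exists>a a' r. automorphism a \<and> automorphism a' \<and> a \<circ> a' = id \<and> a' \<circ> a = id \<and> automorphism r \<and> r \<circ> r = id \<and> r \<noteq> id \<and>
     swapped g = a \<circ> r \<circ> a' \<circ> r"
    using * by (intro exI[of _ "swapped a"] exI[of _ "swapped a'"] exI[of _ "swapped r"])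
      (simp add: automorphism_swapped flip: swapped_comp)
qed

lemma inv_Aut:
  assumes "f \<in> carrier Aut" "f \<circ> g = id" "g \<circ> f = id"
  shows "inv\<^bsub>Aut\<^esub> f = g"
proof -
  interpret A: group Aut by (rule group_Aut)
  have "f \<circ> inv\<^bsub>Aut\<^esub> f = id" using A.r_inv[OF assms(1)] by simp
  then have "g \<circ> (f \<circ> inv\<^bsub>Aut\<^esub> f) = g" by simp
  then show ?thesis using assms(3) by (simp flip: comp_assoc)
qed

lemma involutive_commutator_lift:
  assumes "involutive_commutator g"
  shows "\<exists>a\<in>carrier Aut. \<exists>b\<in>carrier Aut. lift g = commutator Aut a b"
    and "\<exists>hs. set hs \<subseteq> involutions Aut \<and> lift g = foldr (\<otimes>\<^bsub>Aut\<^esub>) hs \<one>\<^bsub>Aut\<^esub>"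
    and "automorphism g" and "\<exists>g'. automorphism g' \<and> g \<circ> g' = id \<and> g' \<circ> g = id"
proof -
  from assms obtain a a' r where *: "automorphism a" "automorphism a'" "a \<circ> a' = id" "a' \<circ> a = id" "automorphism r" "r \<circ> r = id" "r \<noteq> id"
    and g: "g = a \<circ> r \<circ> a' \<circ> r" unfolding involutive_commutator_def by blast
  have c: "lift a \<in> carrier Aut" "lift r \<in> carrier Aut" "lift (a \<circ> r \<circ> a') \<in> carrier Aut"
    using * automorphism_comp by (auto simp: automorphism_def)
  have "inv\<^bsub>Aut\<^esub> (lift a) = lift a'" "inv\<^bsub>Aut\<^esub> (lift r) = lift r"
    using c * by (auto intro!: inv_Aut simp flip: lift_comp)
  then have "lift g = commutator Aut (lift a) (lift r)"
    by (simp add: commutator_def g lift_comp)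
  then show "\<exists>a\<in>carrier Aut. \<exists>b\<in>carrier Aut. lift g = commutator Aut a b"
    using c by blast
  have p: "a (a' x) = x" "a' (a x) = x" "r (r x) = x" for x
    using * by (simp_all add: pointfree_idE)
  have s: "(a \<circ> r \<circ> a') \<circ> (a \<circ> r \<circ> a') = id"
    by (simp add: fun_eq_iff p)
  \<comment> \<open>The conjugate must differ from the identity to count as an involution;
    cancelling \<open>a\<close> would force \<open>r = id\<close>.\<close>
  have "a \<circ> r \<circ> a' \<noteq> id"
  proof
    assume "a \<circ> r \<circ> a' = id"
    then have "a (r (a' (a x))) = a x" for x by (metis comp_apply id_apply)
    then have "a' (a (r x)) = a' (a x)" for x by (simp add: p)
    then have "r = id" by (simp add: fun_eq_iff p)
    with \<open>r \<noteq> id\<close> show False ..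
  qed
  then have "set [lift (a \<circ> r \<circ> a'), lift r] \<subseteq> involutions Aut"
    using c s * by (auto simp: involutions_def simp flip: lift_comp dest: lift_inj[where g = id, simplified])
  then show "\<exists>hs. set hs \<subseteq> involutions Aut \<and> lift g = foldr (\<otimes>\<^bsub>Aut\<^esub>) hs \<one>\<^bsub>Aut\<^esub>"
    by (intro exI[of _ "[lift (a \<circ> r \<circ> a'), lift r]"]) (simp add: g lift_comp)
  show "automorphism g" unfolding g by (intro automorphism_comp *)
  have "automorphism (r \<circ> a \<circ> r \<circ> a')" by (intro automorphism_comp *)
  moreover have "g \<circ> (r \<circ> a \<circ> r \<circ> a') = id" "(r \<circ> a \<circ> r \<circ> a') \<circ> g = id"
    by (simp_all add: g fun_eq_iff p)
  ultimately show "\<exists>g'. automorphism g' \<and> g \<circ> g' = id \<and> g' \<circ> g = id" by blast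
qed

section \<open>Gates\<close>

definition slide :: "int \<Rightarrow> track \<times> track \<Rightarrow> track \<times> track" where
  "slide m = (\<lambda>(t, b). (translate m t, b))"

definition counterslide :: "track \<times> track \<Rightarrow> track \<times> track" where
  "counterslide = (\<lambda>(t, b). (translate (-1) t, translate 1 b))"

text \<open>The four preceding zeros keep two leads at least five cells apart, so a pulse written at
  one lead stays out of the window that \<open>active\<close> reads around the pulse of
  another.\<close>

definition lead :: "track \<Rightarrow> track" where
  "lead t = (\<lambda>i. t i \<and> \<not> t (i - 1) \<and> \<not> t (i - 2) \<and> \<not> t (i - 3) \<and> \<not> t (i - 4))"

text \<open>It squares to the identity, and its commutator with a slide by one is
  \<open>pulse_gate n\<close>, since sliding \<open>t\<close> moves its leads along.\<close>

definition lead_gate :: "int \<Rightarrow> track \<times> track \<Rightarrow> track \<times> track" where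
  "lead_gate n = (\<lambda>(t, b). (t, b \<oplus>\<oplus> translate n (lead t)))"

definition pulse_gate :: "int \<Rightarrow> track \<times> track \<Rightarrow> track \<times> track" where
  "pulse_gate n = (\<lambda>(t, b). (t, b \<oplus>\<oplus> (translate n (lead t) \<oplus>\<oplus> translate (n + 1) (lead t))))"

text \<open>
  \<open>active b i\<close> says that \<open>b\<close> reads \<open>001xy00\<close> on the cells \<open>i - 2, \<dots>, i + 4\<close>. The code \<open>(x, y)\<close> does not
  influence which cells are active, so all active codes can be permuted simultaneously.
\<close>

definition active :: "track \<Rightarrow> track" where
  "active b = (\<lambda>i. b i \<and> \<not> b (i - 1) \<and> \<not> b (i - 2) \<and> \<not> b (i + 3) \<and> \<not> b (i + 4))"

definition recode :: "(int \<Rightarrow> bool \<times> bool \<Rightarrow> bool \<times> bool) \<Rightarrow> track \<Rightarrow> track" where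
  "recode p b = (\<lambda>i. if active b (i - 1) then fst (p (i - 1) (b i, b (i + 1)))
     else if active b (i - 2) then snd (p (i - 2) (b (i - 1), b i)) else b i)"

definition code_gate :: "(track \<Rightarrow> int \<Rightarrow> bool \<times> bool \<Rightarrow> bool \<times> bool) \<Rightarrow> track \<times> track \<Rightarrow> track \<times> track" where
  "code_gate P = (\<lambda>(t, b). (t, recode (P t) b))"

text \<open>Three kinds of cells occur. For an active cell, the cells that decide activity carry no
  code bits. A code cell stays inactive because the marker before it is kept. Any other cell that
  carries a one can see a change only at \<open>i + 4\<close>.\<close>

lemma active_recode: "active (recode p b) = active b"
proof
  fix i
  have *: "recode p b j = b j" if "\<not> active b (j - 1)" "\<not> active b (j - 2)" for j
    using that by (simp add: recode_def)
  consider "active b i" | "\<not> active b i" "active b (i - 1) \<or> active b (i - 2)"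
    | "\<not> active b i" "\<not> active b (i - 1)" "\<not> active b (i - 2)" by blast
  then show "active (recode p b) i = active b i"
  proof cases
    case 1
    then have "recode p b j = b j" if "j \<in> {i, i - 1, i - 2, i + 3, i + 4}" for j
      using that by (intro *) (auto simp: active_def add.commute diff_diff_eq)
    then show ?thesis by (simp add: active_def)
  next
    case 2
    then have "b (i - 1) \<and> recode p b (i - 1) \<or> b (i - 2) \<and> recode p b (i - 2)"
      by (auto simp: active_def recode_def diff_diff_eq)
    then show ?thesis using 2 by (auto simp: active_def)
  next
    case 3
    have i: "recode p b i = b i" using 3 by (intro *)
    show ?thesis
    proof (cases "b i")
      case True
      have "recode p b j = b j" if "j \<in> {i - 1, i - 2, i + 3}" for j
      proof (rule *)
        show "\<not> active b (j - 1)" "\<not> active b (j - 2)" using that 3 True by (auto simp: active_def algebra_simps)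
      qed
      \<comment> \<open>A change at \<open>i + 4\<close> would require \<open>i + 3\<close> to be
        active, and then the marker at \<open>i + 3\<close> blocks \<open>i\<close> before and
        after.\<close>
      moreover have "recode p b (i + 4) = b (i + 4)" if "\<not> b (i + 3)"
      proof (rule *)
        show "\<not> active b (i + 4 - 1)" "\<not> active b (i + 4 - 2)" using that 3 True by (auto simp: active_def algebra_simps)
      qed
      ultimately show ?thesis by (auto simp: active_def i)
    qed (simp add: active_def i)
  qed
qed

text \<open>Activity survives the first recoding, and no two active cells are one or two apart.
  Hence every code is read and written as a unit, and the maps on codes simply compose.\<close>

lemma recode_recode: "recode p (recode q b) = recode (\<lambda>i. p i \<circ> q i) b"
proof
  fix i
  have 1: "\<not> active b i" "\<not> active b (i - 2)" if "active b (i - 1)"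
    using that by (auto simp: active_def algebra_simps)
  have 2: "\<not> active b i" "\<not> active b (i - 1)" if "active b (i - 2)"
    using that by (auto simp: active_def algebra_simps)
  show "recode p (recode q b) i = recode (\<lambda>i. p i \<circ> q i) b i"
    using 1 2 by (simp add: recode_def active_recode[unfolded recode_def])
qed

lemma recode_id: "recode (\<lambda>_. id) b = b"
  by (auto simp: recode_def fun_eq_iff)

lemma code_gate_comp: "code_gate P \<circ> code_gate Q = code_gate (\<lambda>t i. P t i \<circ> Q t i)"
  by (auto simp: code_gate_def recode_recode fun_eq_iff)

lemma code_gate_id [simp]: "code_gate (\<lambda>_ _. id) = id"
  by (auto simp: code_gate_def recode_id fun_eq_iff)

lemma translate_translate [simp]: "translate p (translate q t) = translate (p + q) t"
  by (simp add: translate_def diff_diff_eq)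

lemma translate_0 [simp]: "translate 0 t = t"
  by (simp add: translate_def)

lemma translate_xor: "translate q (a \<oplus>\<oplus> b) = translate q a \<oplus>\<oplus> translate q b"
  by (simp add: translate_def xor_track_def)

lemma xor_cancel [simp]: "a \<oplus>\<oplus> b \<oplus>\<oplus> b = a"
  by (auto simp: xor_track_def)

lemma lead_translate: "lead (translate q t) = translate q (lead t)"
  by (simp add: lead_def translate_def algebra_simps)

lemma recode_translate: "recode p (translate q b) = translate q (recode (\<lambda>i. p (i + q)) b)"
proof -
  have "active (translate q b) = translate q (active b)" by (simp add: active_def translate_def algebra_simps)
  then show ?thesis by (simp add: recode_def translate_def algebra_simps)
qed

definition flip :: "bool \<times> bool \<Rightarrow> bool \<times> bool" where
  "flip = (\<lambda>(x, y). (y, x))"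

text \<open>A linear map of order three over the two-element field: it fixes 00 and cycles 10, 11,
  01. Together with \<open>flip\<close> it generates the symmetric group on these three
  codes.\<close>

definition cyc :: "bool \<times> bool \<Rightarrow> bool \<times> bool" where
  "cyc = (\<lambda>(x, y). (x \<noteq> y, x))"

lemma flip_flip: "flip \<circ> flip = id"
  by (auto simp: flip_def fun_eq_iff)

lemma cyc_cyc_cyc: "cyc \<circ> (cyc \<circ> cyc) = id" "(cyc \<circ> cyc) \<circ> cyc = id"
  by (auto simp: cyc_def fun_eq_iff)

text \<open>Control by a single bit gives an involution. Its commutator with a slide is a
  \<open>diff_gate\<close>, which is why the later controls see only differences of neighbouring
  bits.\<close>

definition bit_gate :: "int \<Rightarrow> track \<times> track \<Rightarrow> track \<times> track" where
  "bit_gate m = code_gate (\<lambda>t i. if t (i + m) then flip else id)"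

definition diff_gate :: "int \<Rightarrow> track \<times> track \<Rightarrow> track \<times> track" where
  "diff_gate m = code_gate (\<lambda>t i. if t (i + m) \<noteq> t (i + m + 1) then flip else id)"

definition const_gate :: "(bool \<times> bool \<Rightarrow> bool \<times> bool) \<Rightarrow> track \<times> track \<Rightarrow> track \<times> track" where
  "const_gate p = code_gate (\<lambda>_ _. p)"

lemma automorphism_slide: "automorphism (slide m)"
proof (rule automorphismI[where r = "\<bar>m\<bar>" and f' = "slide (- m)"])
  show "local_map \<bar>m\<bar> (slide m)" "local_map \<bar>m\<bar> (slide (- m))"
    by (auto simp: local_map_def slide_def translate_def)
qed (auto simp: equivariant_def translate_pair_def zero_pair_def slide_def add.commute, auto simp: translate_def)

lemma automorphism_lead_gate: "automorphism (lead_gate n)"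
proof (rule automorphismI[where r = "\<bar>n\<bar> + 10" and f' = "lead_gate n"])
  show "local_map (\<bar>n\<bar> + 10) (lead_gate n)"
    by (auto simp: local_map_def lead_gate_def translate_def lead_def xor_track_def)
  then show "local_map (\<bar>n\<bar> + 10) (lead_gate n)" .
qed (auto simp: equivariant_def translate_pair_def zero_pair_def lead_gate_def lead_translate translate_xor add.commute,
     auto simp: translate_def xor_track_def lead_def)

text \<open>At \<open>i\<close>, \<open>recode\<close> consults its first argument only at
  \<open>i - 1\<close> and \<open>i - 2\<close>, and cells of \<open>b\<close> within distance four;
  the margin 10 covers this.\<close>

lemma local_code_gate:
  assumes "\<And>t t' i. (\<And>j. \<bar>j - i\<bar> \<le> r \<Longrightarrow> t j = t' j) \<Longrightarrow> P t i = P t' i"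
  shows "local_map (\<bar>r\<bar> + 10) (code_gate P)"
  unfolding local_map_def
proof (intro allI impI)
  fix x y :: "track \<times> track" and i
  assume *: "\<forall>j. \<bar>j - i\<bar> \<le> \<bar>r\<bar> + 10 \<longrightarrow> fst x j = fst y j \<and> snd x j = snd y j"
  have "P (fst x) j = P (fst y) j" if "\<bar>j - i\<bar> \<le> 2" for j
    by (rule assms) (use * that in auto)
  then have P: "P (fst x) (i - 1) = P (fst y) (i - 1)" "P (fst x) (i - 2) = P (fst y) (i - 2)" by auto
  have "snd x j = snd y j" if "\<bar>j - i\<bar> \<le> 10" for j using * that by auto
  then have "recode p (snd x) i = recode p (snd y) i" for p
    by (auto simp: recode_def active_def)
  moreover have "recode (P (fst x)) (snd y) i = recode (P (fst y)) (snd y) i"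
    by (simp add: recode_def P)
  ultimately show "fst (code_gate P x) i = fst (code_gate P y) i \<and> snd (code_gate P x) i = snd (code_gate P y) i"
    using * by (simp add: code_gate_def case_prod_beta)
qed

lemma equivariant_code_gate:
  assumes "\<And>q t i. P (translate q t) (i + q) = P t i"
  shows "equivariant (code_gate P)"
  by (auto simp: equivariant_def code_gate_def translate_pair_def recode_translate assms)

lemma code_gate_zero_pair: "code_gate P zero_pair = zero_pair"
  by (simp add: code_gate_def zero_pair_def recode_def active_def)

lemma automorphism_bit_gate: "automorphism (bit_gate m)" and bit_gate_bit_gate: "bit_gate m \<circ> bit_gate m = id"
proof -
  show inv: "bit_gate m \<circ> bit_gate m = id"
    unfolding bit_gate_def code_gate_comp by (simp add: if_distrib flip_flip cong: if_cong)
  have l: "local_map (\<bar>\<bar>m\<bar>\<bar> + 10) (bit_gate m)"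
    unfolding bit_gate_def by (rule local_code_gate) simp
  have e: "equivariant (bit_gate m)"
    unfolding bit_gate_def by (rule equivariant_code_gate) (simp add: translate_def algebra_simps)
  show "automorphism (bit_gate m)"
    by (rule automorphismI[OF l l e]) (use inv in \<open>auto simp: pointfree_idE bit_gate_def[of m] code_gate_zero_pair\<close>)
qed

lemma const_gate_comp: "const_gate p \<circ> const_gate q = const_gate (p \<circ> q)"
  by (simp add: const_gate_def code_gate_comp)

lemma const_gate_id [simp]: "const_gate id = id"
  by (simp add: const_gate_def)

lemma automorphism_const_gate:
  assumes "p \<circ> p' = id" "p' \<circ> p = id"
  shows "automorphism (const_gate p)"
proof (rule automorphismI[where r = "\<bar>0\<bar> + 10" and f' = "const_gate p'"])
  show "local_map (\<bar>0\<bar> + 10) (const_gate p)" "local_map (\<bar>0\<bar> + 10) (const_gate p')"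
    unfolding const_gate_def by (intro local_code_gate refl)+
  show "equivariant (const_gate p)"
    unfolding const_gate_def by (rule equivariant_code_gate) simp
  show "const_gate p zero_pair = zero_pair" by (simp add: const_gate_def code_gate_zero_pair)
  show "const_gate p' (const_gate p x) = x" "const_gate p (const_gate p' x) = x" for x
    using const_gate_comp[of p' p] const_gate_comp[of p p'] assms by (simp_all add: pointfree_idE)
qed

section \<open>The generators as involutive commutators\<close>

lemma involutive_commutator_counterslide: "involutive_commutator counterslide"
  unfolding involutive_commutator_def
proof (intro exI conjI)
  show "automorphism (slide (-1))" "automorphism (slide 1)" "automorphism prod.swap" by (rule automorphism_slide automorphism_swap)+
  show "counterslide = slide (-1) \<circ> prod.swap \<circ> slide 1 \<circ> prod.swap"
    by (auto simp: counterslide_def slide_def)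
  show "prod.swap \<noteq> (id :: track \<times> track \<Rightarrow> _)"
  proof
    assume "prod.swap = (id :: track \<times> track \<Rightarrow> _)"
    then have "prod.swap (\<lambda>_. True, \<lambda>_. False) = (\<lambda>_ :: int. True, \<lambda>_ :: int. False)" by simp
    then show False by (simp add: fun_eq_iff)
  qed
qed (auto simp: slide_def)

lemma involutive_commutator_pulse_gate: "involutive_commutator (pulse_gate n)"
  unfolding involutive_commutator_def
proof (intro exI conjI)
  show "automorphism (slide (-1))" "automorphism (slide 1)" "automorphism (lead_gate n)" by (rule automorphism_slide automorphism_lead_gate)+
  show "pulse_gate n = slide (-1) \<circ> lead_gate n \<circ> slide 1 \<circ> lead_gate n"
    by (auto simp: pulse_gate_def slide_def lead_gate_def lead_translate xor_track_def fun_eq_iff)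
  show "lead_gate n \<circ> lead_gate n = id"
    by (auto simp: lead_gate_def)
  show "lead_gate n \<noteq> id"
  proof
    assume "lead_gate n = id"
    then have "snd (lead_gate n (\<lambda>i. i = 0, \<lambda>_. False)) n = snd ((\<lambda>i :: int. i = 0), (\<lambda>_ :: int. False)) n"
      by simp
    then show False by (simp add: lead_gate_def lead_def xor_track_def translate_def)
  qed
qed (auto simp: slide_def)

lemma code_gate_neq_id:
  assumes "P (\<lambda>_. True) 0 = flip"
  shows "code_gate P \<noteq> id"
proof
  assume "code_gate P = id"
  \<comment> \<open>With ones exactly at 0 and 1, cell 0 is active with code 10, and
    \<open>flip\<close> clears the bit at cell 1.\<close>
  then have "snd (code_gate P (\<lambda>_. True, \<lambda>i. i \<in> {0, 1})) 1 = snd ((\<lambda>_ :: int. True), (\<lambda>i :: int. i \<in> {0, 1})) 1"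
    by simp
  then show False by (simp add: code_gate_def recode_def active_def assms flip_def)
qed

lemma involutive_commutator_diff_gate: "involutive_commutator (diff_gate m)"
  unfolding involutive_commutator_def
proof (intro exI conjI)
  show "automorphism (slide (-1))" "automorphism (slide 1)" "automorphism (bit_gate (m + 1))" by (rule automorphism_slide automorphism_bit_gate)+
  have "slide (-1) \<circ> code_gate P \<circ> slide 1 = code_gate (\<lambda>t. P (translate 1 t))" for P
    by (auto simp: slide_def code_gate_def)
  then show "diff_gate m = slide (-1) \<circ> bit_gate (m + 1) \<circ> slide 1 \<circ> bit_gate (m + 1)"
    unfolding bit_gate_def diff_gate_def
    by (simp only: code_gate_comp, intro arg_cong[where f = code_gate])
      (auto simp: translate_def algebra_simps flip_def fun_eq_iff)
  show "bit_gate (m + 1) \<noteq> id" unfolding bit_gate_def by (rule code_gate_neq_id) simp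
qed (auto simp: slide_def bit_gate_bit_gate)

lemma involutive_commutator_const_gate: "involutive_commutator (const_gate cyc)"
  unfolding involutive_commutator_def
proof (intro exI conjI)
  show "automorphism (const_gate (cyc \<circ> cyc))" "automorphism (const_gate cyc)" "automorphism (const_gate flip)"
    using automorphism_const_gate cyc_cyc_cyc flip_flip by metis+
  \<comment> \<open>Conjugation by \<open>flip\<close> inverts \<open>cyc\<close>, so the right-hand
    side is the square of \<open>cyc\<close> times its inverse.\<close>
  have "cyc = (cyc \<circ> cyc) \<circ> flip \<circ> cyc \<circ> flip" by (auto simp: cyc_def flip_def fun_eq_iff)
  then show "const_gate cyc = const_gate (cyc \<circ> cyc) \<circ> const_gate flip \<circ> const_gate cyc \<circ> const_gate flip"
    by (simp add: const_gate_comp)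
  show "const_gate flip \<noteq> id" unfolding const_gate_def by (rule code_gate_neq_id) simp
qed (simp_all add: const_gate_comp flip_flip cyc_cyc_cyc)

section \<open>The group generated by the gates\<close>

text \<open>Offsets 0 and 1 represent both parities: \<open>counterslide\<close> moves the tracks by
  two relative to each other, and conjugation with it reaches all other offsets.\<close>

definition base_gates :: "(track \<times> track \<Rightarrow> track \<times> track) set" where
  "base_gates = {counterslide, pulse_gate 0, pulse_gate 1, diff_gate 0, diff_gate 1, const_gate cyc}"

definition gates :: "(track \<times> track \<Rightarrow> track \<times> track) set" where
  "gates = base_gates \<union> swapped ` base_gates"

lemma involutive_commutator_gates: "g \<in> gates \<Longrightarrow> involutive_commutator g"
  using involutive_commutator_counterslide involutive_commutator_pulse_gate involutive_commutator_diff_gate involutive_commutator_const_gate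
  by (auto simp: gates_def base_gates_def involutive_commutator_swapped)

lemma swapped_gates: "g \<in> gates \<Longrightarrow> swapped g \<in> gates"
  by (auto simp: gates_def)

text \<open>The generated group on the level of track pairs, as words extended on the left by a gate
  or by a two-sided inverse of one; \<open>lift_gate_group\<close> transfers it to
  \<open>Aut\<close>.\<close>

inductive in_gate_group :: "(track \<times> track \<Rightarrow> track \<times> track) \<Rightarrow> bool" where
  "in_gate_group id"
| "g \<in> gates \<Longrightarrow> in_gate_group f \<Longrightarrow> in_gate_group (g \<circ> f)"
| "g \<in> gates \<Longrightarrow> g' \<circ> g = id \<Longrightarrow> g \<circ> g' = id \<Longrightarrow> in_gate_group f \<Longrightarrow> in_gate_group (g' \<circ> f)"

definition gate_group :: "(track \<times> track \<Rightarrow> track \<times> track) set" where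
  "gate_group = {f. in_gate_group f}"

lemma gate_group_id: "id \<in> gate_group"
  and gate_group_step: "g \<in> gates \<Longrightarrow> f \<in> gate_group \<Longrightarrow> g \<circ> f \<in> gate_group"
  and gate_group_inv_step: "g \<in> gates \<Longrightarrow> g' \<circ> g = id \<Longrightarrow> g \<circ> g' = id \<Longrightarrow> f \<in> gate_group \<Longrightarrow> g' \<circ> f \<in> gate_group"
  by (simp_all add: gate_group_def in_gate_group.intros)

lemma gate_group_induct [consumes 1, case_names Id Step Inv]:
  assumes "f \<in> gate_group" "P id"
    and "\<And>g f. g \<in> gates \<Longrightarrow> f \<in> gate_group \<Longrightarrow> P f \<Longrightarrow> P (g \<circ> f)"
    and "\<And>g g' f. g \<in> gates \<Longrightarrow> g' \<circ> g = id \<Longrightarrow> g \<circ> g' = id \<Longrightarrow> f \<in> gate_group \<Longrightarrow> P f \<Longrightarrow> P (g' \<circ> f)"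
  shows "P f"
proof -
  have "in_gate_group f" using assms(1) by (simp add: gate_group_def)
  then show ?thesis
  proof induction
    case 1
    show ?case using assms(2) by (simp only: id_def)
  next
    case (2 g f)
    have "P (g \<circ> f)" by (rule assms(3)) (use 2 in \<open>auto simp: gate_group_def\<close>)
    then show ?case by (simp only: comp_def)
  next
    case (3 g g' f)
    have "P (g' \<circ> f)" by (rule assms(4)) (use 3 in \<open>auto simp: gate_group_def\<close>)
    then show ?case by (simp only: comp_def)
  qed
qed

lemma gate_group_comp: "f \<in> gate_group \<Longrightarrow> g \<in> gate_group \<Longrightarrow> f \<circ> g \<in> gate_group"
  by (induction rule: gate_group_induct) (auto simp: comp_assoc intro: gate_group_id gate_group_step gate_group_inv_step)

lemma gates_gate_group: "g \<in> gates \<Longrightarrow> g \<in> gate_group"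
  using gate_group_step[OF _ gate_group_id] by simp

lemma gates_inv_gate_group: "g \<in> gates \<Longrightarrow> g' \<circ> g = id \<Longrightarrow> g \<circ> g' = id \<Longrightarrow> g' \<in> gate_group"
  using gate_group_inv_step[OF _ _ _ gate_group_id] by simp

lemma gate_group_inv: "f \<in> gate_group \<Longrightarrow> \<exists>f'\<in>gate_group. \<forall>x. f' (f x) = x"
proof (induction rule: gate_group_induct)
  case Id
  show ?case using gate_group_id by (intro bexI[of _ id]) auto
next
  case (Step g f)
  obtain f' where f': "f' \<in> gate_group" "\<forall>x. f' (f x) = x" using Step by blast
  obtain g' where g': "g \<circ> g' = id" "g' \<circ> g = id"
    using involutive_commutator_lift(4)[OF involutive_commutator_gates[OF Step(1)]] by blast
  then have "f' \<circ> g' \<in> gate_group" using f' Step gates_inv_gate_group gate_group_comp by blast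
  moreover have "g' (g x) = x" for x using g' by (simp add: pointfree_idE)
  ultimately show ?case using f' by (intro bexI[of _ "f' \<circ> g'"]) auto
next
  case (Inv g g' f)
  obtain f' where f': "f' \<in> gate_group" "\<forall>x. f' (f x) = x" using Inv by blast
  have "f' \<circ> g \<in> gate_group" using f' Inv gates_gate_group gate_group_comp by blast
  moreover have "g (g' x) = x" for x using Inv by (simp add: pointfree_idE)
  ultimately show ?case using f' by (intro bexI[of _ "f' \<circ> g"]) auto
qed

lemma swapped_gate_group: "f \<in> gate_group \<Longrightarrow> swapped f \<in> gate_group"
proof (induction rule: gate_group_induct)
  case (Inv g g' f)
  then have "swapped g' \<circ> swapped f \<in> gate_group"
    by (intro gate_group_inv_step[of "swapped g"]) (auto simp: swapped_gates simp flip: swapped_comp)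
  then show ?case by (simp only: swapped_comp)
qed (simp_all only: swapped_id swapped_comp swapped_gates gate_group_id gate_group_step)

lemma gate_group_automorphism: "f \<in> gate_group \<Longrightarrow> automorphism f"
proof (induction rule: gate_group_induct)
  case Id
  show ?case by (rule automorphismI[where f' = id and r = 0]) (auto simp: local_map_def equivariant_def)
next
  case (Step g f)
  then show ?case using automorphism_comp involutive_commutator_lift(3)[OF involutive_commutator_gates] by blast
next
  case (Inv g g' f)
  obtain g'' where "automorphism g''" "g \<circ> g'' = id"
    using involutive_commutator_lift(4)[OF involutive_commutator_gates[OF Inv(1)]] by blast
  \<comment> \<open>A left and a right inverse of \<open>g\<close> coincide, so \<open>g'\<close> is
    the inverse already known to be an automorphism.\<close>
  moreover have "g' = g''" using calculation Inv(2) by (metis comp_assoc comp_id id_comp)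
  ultimately show ?case using Inv automorphism_comp by blast
qed

lemma lift_gate_group: "f \<in> gate_group \<Longrightarrow> lift f \<in> generate Aut (lift ` gates)"
proof (induction rule: gate_group_induct)
  case Id
  show ?case using generate.one[of "Aut :: (4 config \<Rightarrow> 4 config) monoid"] by (simp only: lift_id one_Aut)
next
  case (Step g f)
  have "lift g \<otimes>\<^bsub>Aut\<^esub> lift f \<in> generate Aut (lift ` gates)"
    by (rule generate.eng[OF generate.incl]) (use Step in auto)
  then show ?case by (simp only: mult_Aut lift_comp)
next
  case (Inv g g' f)
  have "lift g \<in> carrier Aut" using involutive_commutator_lift(3)[OF involutive_commutator_gates[OF Inv(1)]] by (simp add: automorphism_def)
  then have "inv\<^bsub>Aut\<^esub> (lift g) = lift g'"
    using Inv by (intro inv_Aut) (simp_all flip: lift_comp)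
  moreover have "inv\<^bsub>Aut\<^esub> (lift g) \<otimes>\<^bsub>Aut\<^esub> lift f \<in> generate Aut (lift ` gates)"
    by (rule generate.eng[OF generate.inv]) (use Inv in auto)
  ultimately show ?case by (simp only: mult_Aut lift_comp)
qed

section \<open>Gates with arbitrary offsets and finite sets of conditions\<close>

lemma int_step2_induct:
  fixes P :: "int \<Rightarrow> bool"
  assumes "P 0" "P 1" "\<And>n. P n \<Longrightarrow> P (n + 2)" "\<And>n. P n \<Longrightarrow> P (n - 2)"
  shows "P n"
proof -
  have "P n \<and> P (n + 1)"
  proof (induction n rule: int_induct[where k = 0])
    case base
    then show ?case using assms by simp
  next
    case (step1 i)
    then show ?case using assms(3)[of i] by (simp add: add.commute)
  next
    case (step2 i)
    then show ?case using assms(4)[of "i + 1"] by (simp add: algebra_simps)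
  qed
  then show ?thesis by blast
qed

lemma counterslide_inv:
  "(\<lambda>(t, b). (translate 1 t, translate (-1) b)) \<circ> counterslide = id" "counterslide \<circ> (\<lambda>(t, b). (translate 1 t, translate (-1) b)) = id"
  by (auto simp: counterslide_def)

lemma conj_counterslide_gate_group:
  assumes "f \<in> gate_group"
  shows "counterslide \<circ> f \<circ> (\<lambda>(t, b). (translate 1 t, translate (-1) b)) \<in> gate_group"
    and "(\<lambda>(t, b). (translate 1 t, translate (-1) b)) \<circ> f \<circ> counterslide \<in> gate_group"
proof -
  have "counterslide \<in> gates" by (simp add: gates_def base_gates_def)
  then have "counterslide \<in> gate_group" "(\<lambda>(t, b). (translate 1 t, translate (-1) b)) \<in> gate_group"
    using gates_gate_group gates_inv_gate_group counterslide_inv by blast+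
  then show "counterslide \<circ> f \<circ> (\<lambda>(t, b). (translate 1 t, translate (-1) b)) \<in> gate_group"
    "(\<lambda>(t, b). (translate 1 t, translate (-1) b)) \<circ> f \<circ> counterslide \<in> gate_group"
    using assms gate_group_comp by blast+
qed

lemma pulse_gate_gate_group: "pulse_gate n \<in> gate_group"
proof (induction n rule: int_step2_induct)
  case (3 n)
  have "counterslide \<circ> pulse_gate n \<circ> (\<lambda>(t, b). (translate 1 t, translate (-1) b)) = pulse_gate (n + 2)"
    by (auto simp: fun_eq_iff pulse_gate_def counterslide_def lead_translate translate_xor algebra_simps)
  then show ?case using conj_counterslide_gate_group(1)[OF 3] by simp
next
  case (4 n)
  have "(\<lambda>(t, b). (translate 1 t, translate (-1) b)) \<circ> pulse_gate n \<circ> counterslide = pulse_gate (n - 2)"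
    by (auto simp: fun_eq_iff pulse_gate_def counterslide_def lead_translate translate_xor algebra_simps)
  then show ?case using conj_counterslide_gate_group(2)[OF 4] by simp
qed (auto intro!: gates_gate_group simp: gates_def base_gates_def)

lemma conj_counterslide_code_gate:
  "counterslide \<circ> code_gate P \<circ> (\<lambda>(t, b). (translate 1 t, translate (-1) b)) = code_gate (\<lambda>t i. P (translate 1 t) (i - 1))"
  "(\<lambda>(t, b). (translate 1 t, translate (-1) b)) \<circ> code_gate P \<circ> counterslide = code_gate (\<lambda>t i. P (translate (-1) t) (i + 1))"
  by (rule ext, simp add: code_gate_def counterslide_def recode_translate split: prod.split)+

lemma diff_gate_gate_group: "diff_gate m \<in> gate_group"
proof (induction m rule: int_step2_induct)
  case (3 n)
  have "(\<lambda>(t, b). (translate 1 t, translate (-1) b)) \<circ> diff_gate n \<circ> counterslide = diff_gate (n + 2)"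
    unfolding diff_gate_def conj_counterslide_code_gate by (simp add: translate_def algebra_simps)
  then show ?case using conj_counterslide_gate_group(2)[OF 3] by simp
next
  case (4 n)
  have "counterslide \<circ> diff_gate n \<circ> (\<lambda>(t, b). (translate 1 t, translate (-1) b)) = diff_gate (n - 2)"
    unfolding diff_gate_def conj_counterslide_code_gate by (simp add: translate_def algebra_simps)
  then show ?case using conj_counterslide_gate_group(1)[OF 4] by simp
qed (auto intro!: gates_gate_group simp: gates_def base_gates_def)

text \<open>A partial pattern for the track of differences, with offsets \<open>a\<close> measured
  from \<open>i\<close>.\<close>

definition holds :: "(int \<times> bool) set \<Rightarrow> track \<Rightarrow> int \<Rightarrow> bool" where
  "holds C t i \<longleftrightarrow> (\<forall>(a, e)\<in>C. (t (i + a) \<noteq> t (i + a + 1)) = e)"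

lemma holds_insert:
  "holds (insert (a, e) C) t i \<longleftrightarrow> (t (i + a) \<noteq> t (i + a + 1)) = e \<and> holds C t i"
  by (simp add: holds_def)

definition cond_gate :: "(int \<times> bool) set \<Rightarrow> track \<times> track \<Rightarrow> track \<times> track" where
  "cond_gate C = code_gate (\<lambda>t i. if holds C t i then cyc else id)"

text \<open>
  With \<open>K\<close> controlled by \<open>p\<close> and \<open>D\<close> by \<open>q\<close>, the commutator of \<open>K\<close> and \<open>D\<close> is \<open>cyc\<^sup>2\<close> controlled by both;
  here \<open>K\<close> has order three, so that \<open>K \<circ> K\<close> is its inverse.
\<close>

lemma commutator_conjunction:
  fixes p q :: bool
  defines "K \<equiv> if p then cyc else id" and "D \<equiv> if q then flip else id"
    and "L \<equiv> if q = True \<and> p then cyc else id"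
  shows "(K \<circ> D \<circ> (K \<circ> K) \<circ> D) \<circ> (K \<circ> D \<circ> (K \<circ> K) \<circ> D) = L"
    and "K \<circ> (L \<circ> L) = (if q = False \<and> p then cyc else id)"
  unfolding assms by (cases p; cases q; simp add: fun_eq_iff all_bool_eq cyc_def flip_def)+

text \<open>Conditions are added one at a time. The squared commutator with
  \<open>diff_gate a\<close> enforces a difference at \<open>a\<close>; composing the old gate with
  the inverse of the new one leaves exactly the case without a difference.\<close>

lemma cond_gate_gate_group:
  assumes "finite C"
  shows "cond_gate C \<in> gate_group"
  using assms
proof induction
  case empty
  have "cond_gate {} = const_gate cyc" by (simp add: cond_gate_def const_gate_def holds_def)
  then show ?case by (auto intro!: gates_gate_group simp: gates_def base_gates_def)
next
  case (insert c C)
  obtain a e where c: "c = (a, e)" by force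
  let ?K = "cond_gate C" and ?D = "diff_gate a"
  let ?g = "?K \<circ> ?D \<circ> (?K \<circ> ?K) \<circ> ?D"
  have g: "?g \<in> gate_group" by (intro gate_group_comp insert.IH diff_gate_gate_group)
  have eq: "?g \<circ> ?g = cond_gate (insert (a, True) C)"
    unfolding cond_gate_def diff_gate_def code_gate_comp holds_insert
    by (rule arg_cong[where f = code_gate], rule ext, rule ext, rule commutator_conjunction(1))
  have T: "cond_gate (insert (a, True) C) \<in> gate_group"
    using gate_group_comp[OF g g] unfolding eq .
  have eq': "?K \<circ> (cond_gate (insert (a, True) C) \<circ> cond_gate (insert (a, True) C)) = cond_gate (insert (a, False) C)"
    unfolding cond_gate_def code_gate_comp holds_insert
    by (rule arg_cong[where f = code_gate], rule ext, rule ext, rule commutator_conjunction(2))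
  have "cond_gate (insert (a, False) C) \<in> gate_group"
    using gate_group_comp[OF insert.IH gate_group_comp[OF T T]] unfolding eq' .
  with T show ?case unfolding c by (cases e) auto
qed

section \<open>Controlled addition of a single bit\<close>

lemma finite_track_translate [simp]: "finite_track (translate q t) \<longleftrightarrow> finite_track t"
proof -
  have "{i. translate q t i} = (\<lambda>i. i + q) ` {i. t i}"
    by (auto simp: translate_def image_iff intro!: exI[of _ "_ - q"])
  then show ?thesis by (simp add: finite_track_def finite_image_iff inj_on_def)
qed

lemma nonzero_track_translate [simp]: "nonzero_track (translate q t) \<longleftrightarrow> nonzero_track t"
  unfolding nonzero_track_def translate_def by (metis add_diff_cancel_right')

lemma finite_track_xor: "finite_track a \<Longrightarrow> finite_track b \<Longrightarrow> finite_track (a \<oplus>\<oplus> b)"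
  unfolding finite_track_def xor_track_def
  by (rule finite_subset[of _ "{i. a i} \<union> {i. b i}"]) auto

lemma finite_track_lead: "finite_track t \<Longrightarrow> finite_track (lead t)"
  unfolding finite_track_def lead_def by (rule rev_finite_subset) auto

lemma finite_track_bound:
  assumes "finite_track t"
  shows "\<exists>R. \<forall>i. t i \<longrightarrow> \<bar>i\<bar> \<le> R"
proof (intro exI allI impI)
  show "\<bar>i\<bar> \<le> Max (abs ` {i. t i})" if "t i" for i
    using assms that by (intro Max_ge) (auto simp: finite_track_def)
qed

lemma finite_track_least:
  assumes "finite_track t" "nonzero_track t"
  shows "\<exists>m. t m \<and> (\<forall>i. t i \<longrightarrow> m \<le> i)"
proof -
  have "finite {i. t i}" "{i. t i} \<noteq> {}" using assms by (auto simp: finite_track_def nonzero_track_def)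
  then show ?thesis using Min_in[of "{i. t i}"] by (intro exI[of _ "Min {i. t i}"]) auto
qed

text \<open>The leftmost one serves, since nothing precedes it.\<close>

lemma finite_track_lead_nonzero_track:
  assumes "finite_track t" "nonzero_track t"
  obtains p where "lead t p" "\<not> lead t (p - 1)"
proof -
  obtain m where m: "t m" "\<And>i. t i \<Longrightarrow> m \<le> i" using finite_track_least[OF assms] by blast
  have "\<not> t (m - d)" if "d > 0" for d using m(2)[of "m - d"] that by auto
  then show ?thesis using m(1) by (intro that[of m]) (auto simp: lead_def)
qed

text \<open>Comparing leftmost ones shows that a nonzero finite track has no period. Its position
  within its translation orbit is therefore well defined.\<close>

lemma translate_unique:
  assumes "finite_track u" "nonzero_track u" "translate q u = translate q' u"
  shows "q = q'"
proof -
  obtain m where m: "u m" "\<And>i. u i \<Longrightarrow> m \<le> i" using finite_track_least[OF assms(1,2)] by blast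
  have e: "u (i - q) = u (i - q')" for i using assms(3) by (simp add: translate_def fun_eq_iff)
  have "u (m + q - q')" "u (m + q' - q)" using e[of "m + q"] e[of "m + q'"] m(1) by auto
  then show ?thesis using m(2)[of "m + q - q'"] m(2)[of "m + q' - q"] by auto
qed

text \<open>Equal differences make \<open>x\<close> and \<open>y\<close> equal or complementary, and
  far out both are zero.\<close>

lemma diff_inj:
  assumes "finite_track x" "finite_track y" "\<And>a. (x a \<noteq> x (a + 1)) = (y a \<noteq> y (a + 1))"
  shows "x = y"
proof -
  have const: "(x a \<noteq> y a) = (x 0 \<noteq> y 0)" for a
  proof (induction a rule: int_induct[where k = 0])
    case (step1 i)
    then show ?case using assms(3)[of i] by auto
  next
    case (step2 i)
    then show ?case using assms(3)[of "i - 1"] by auto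
  qed simp
  obtain R where "\<And>i. x i \<Longrightarrow> \<bar>i\<bar> \<le> R" using finite_track_bound[OF assms(1)] by blast
  obtain R' where "\<And>i. y i \<Longrightarrow> \<bar>i\<bar> \<le> R'" using finite_track_bound[OF assms(2)] by blast
  let ?a = "\<bar>R\<bar> + \<bar>R'\<bar> + 1"
  have "\<not> x ?a" "\<not> y ?a"
    using \<open>\<And>i. x i \<Longrightarrow> \<bar>i\<bar> \<le> R\<close>[of ?a] \<open>\<And>i. y i \<Longrightarrow> \<bar>i\<bar> \<le> R'\<close>[of ?a] by auto
  with const have "x a = y a" for a by metis
  then show ?thesis by blast
qed

text \<open>
  Conditions speak about the differences \<open>t i \<noteq> t (i + 1)\<close> only, which determine a finite track. Including the
  condition at offset \<open>-1\<close>, which holds at \<open>p\<close>, leaves finitely many pairs \<open>(t, q)\<close> to be excluded.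
\<close>

lemma detector:
  assumes S: "finite S" "\<And>t. t \<in> S \<Longrightarrow> finite_track t" and u: "finite_track u" and p: "lead u p"
  obtains C where "finite C" "\<And>t q. t \<in> S \<Longrightarrow> holds C t q \<longleftrightarrow> t = translate (q - p) u"
proof -
  \<comment> \<open>Pairs that pass the test for a difference at offset -1 but must still be
    rejected; finiteness of the tracks makes this set finite.\<close>
  define bad where "bad = {(t, q). t \<in> S \<and> t (q - 1) \<noteq> t q \<and> t \<noteq> translate (q - p) u}"
  have "bad \<subseteq> Sigma S (\<lambda>t. (\<lambda>i. i + 1) ` {i. t i} \<union> {i. t i})"
  proof (rule subsetI)
    fix z assume "z \<in> bad"
    then obtain t q where z: "z = (t, q)" "t \<in> S" "t (q - 1) \<noteq> t q" by (auto simp: bad_def)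
    have "q \<in> (\<lambda>i. i + 1) ` {i. t i}" if "t (q - 1)"
      by (rule image_eqI[of _ _ "q - 1"]) (use that in auto)
    then show "z \<in> Sigma S (\<lambda>t. (\<lambda>i. i + 1) ` {i. t i} \<union> {i. t i})" using z by blast
  qed
  moreover have "finite \<dots>" using S by (auto simp: finite_track_def)
  ultimately have fb: "finite bad" using finite_subset by blast
  \<comment> \<open>If no offset separated the pair, the two recentred tracks would have the same
    differences and hence coincide.\<close>
  have "\<exists>a. (t (q + a) \<noteq> t (q + a + 1)) \<noteq> (u (p + a) \<noteq> u (p + a + 1))" if "(t, q) \<in> bad" for t q
  proof (rule ccontr)
    assume "\<nexists>a. (t (q + a) \<noteq> t (q + a + 1)) \<noteq> (u (p + a) \<noteq> u (p + a + 1))"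
    then have e: "(t (q + a) \<noteq> t (q + a + 1)) = (u (p + a) \<noteq> u (p + a + 1))" for a by blast
    have "translate (- q) t = translate (- p) u"
    proof (rule diff_inj)
      show "finite_track (translate (- q) t)" "finite_track (translate (- p) u)" using that S u by (auto simp: bad_def)
      show "(translate (- q) t a \<noteq> translate (- q) t (a + 1)) = (translate (- p) u a \<noteq> translate (- p) u (a + 1))" for a
        using e[of a] by (simp add: translate_def algebra_simps)
    qed
    then have "translate q (translate (- q) t) = translate q (translate (- p) u)" by simp
    then show False using that by (simp add: bad_def)
  qed
  then obtain f where f: "\<And>t q. (t, q) \<in> bad \<Longrightarrow>
      (t (q + f (t, q)) \<noteq> t (q + f (t, q) + 1)) \<noteq> (u (p + f (t, q)) \<noteq> u (p + f (t, q) + 1))"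
    by (metis (no_types) case_prod_conv)
  \<comment> \<open>One distinguishing offset per bad pair suffices, with the prescribed value read
    off from \<open>u\<close> at \<open>p\<close>.\<close>
  define C where "C = insert (-1, True) ((\<lambda>z. (f z, u (p + f z) \<noteq> u (p + f z + 1))) ` bad)"
  have "holds C t q \<longleftrightarrow> t = translate (q - p) u" if "t \<in> S" for t q
  proof
    assume h: "holds C t q"
    then have "t (q - 1) \<noteq> t q" by (simp add: C_def holds_def)
    moreover have "(t, q) \<notin> bad"
    proof
      assume b: "(t, q) \<in> bad"
      then have "(f (t, q), u (p + f (t, q)) \<noteq> u (p + f (t, q) + 1)) \<in> C" by (auto simp: C_def)
      then show False using h f[OF b] by (auto simp: holds_def)
    qed
    ultimately show "t = translate (q - p) u" using that by (simp add: bad_def)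
  next
    assume t: "t = translate (q - p) u"
    have "\<not> u (p - 1)" "u p" using p by (auto simp: lead_def)
    then show "holds C t q" by (auto simp: C_def holds_def t translate_def algebra_simps)
  qed
  then show ?thesis using that[of C] fb by (simp add: C_def)
qed

lemma holds_shift: "holds ((\<lambda>(a, e). (a - n, e)) ` C) t i \<longleftrightarrow> holds C t (i - n)"
  by (auto simp: holds_def algebra_simps)

text \<open>The first pulse writes 11 on clean cells, which makes an active cell with code 10. Where
  \<open>C\<close> holds, \<open>cyc\<close> turns this code into 11, so the second pulse leaves a
  single bit, two cells to the right of the start of the pulse. Elsewhere the two pulses
  cancel.\<close>

lemma pulse_cond_pulse:
  assumes clean: "\<And>q. holds C t q \<Longrightarrow> lead t q \<and> (\<forall>k\<in>{n + q - 2..n + q + 4}. \<not> b k)"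
  shows "pulse_gate n (cond_gate ((\<lambda>(a, e). (a - n, e)) ` C) (pulse_gate n (t, b))) =
    (t, \<lambda>k. b k \<noteq> holds C t (k - n - 2))"
proof -
  define c where "c = b \<oplus>\<oplus> (translate n (lead t) \<oplus>\<oplus> translate (n + 1) (lead t))"
  let ?P = "\<lambda>i. if holds C t (i - n) then cyc else id"
  have code: "active c i \<and> c (i + 1) \<and> \<not> c (i + 2)" if "holds C t (i - n)" for i
  proof -
    have l: "lead t (i - n)" and b: "\<And>k. k \<in> {i - 2..i + 4} \<Longrightarrow> \<not> b k"
      using clean[OF that] by auto
    have c: "c k = (lead t (k - n) \<noteq> lead t (k - n - 1))" if "k \<in> {i - 2..i + 4}" for k
      using b[OF that] by (simp add: c_def xor_track_def translate_def diff_diff_eq)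
    \<comment> \<open>Leads are at least five apart, so within the window from \<open>i - 2\<close>
      to \<open>i + 4\<close> only the pulse at \<open>i\<close> occurs.\<close>
    have g: "\<not> lead t (i - n + d)" if "d \<in> {-4,-3,-2,-1,1,2,3,4}" for d
      using l that by (auto simp: lead_def algebra_simps)
    show ?thesis
      using g[of "-4"] g[of "-3"] g[of "-2"] g[of "-1"] g[of 1] g[of 2] g[of 3] g[of 4] l
      by (simp add: active_def c algebra_simps)
  qed
  have "recode ?P c k = (c k \<noteq> holds C t (k - n - 2))" for k
  proof -
    consider "active c (k - 1)" | "active c (k - 2)" "\<not> active c (k - 1)" | "\<not> active c (k - 1)" "\<not> active c (k - 2)"
      by blast
    then show ?thesis
    proof cases
      case 1
      then have "\<not> active c (k - 2)" by (auto simp: active_def algebra_simps)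
      then have "\<not> holds C t (k - n - 2)" using code[of "k - 2"] by (auto simp: algebra_simps)
      then show ?thesis using 1 code[of "k - 1"] by (auto simp: recode_def cyc_def algebra_simps)
    next
      case 2
      then show ?thesis using code[of "k - 2"] by (auto simp: recode_def cyc_def algebra_simps)
    next
      case 3
      then have "\<not> holds C t (k - n - 2)" using code[of "k - 2"] by (auto simp: algebra_simps)
      then show ?thesis using 3 by (simp add: recode_def)
    qed
  qed
  then have "recode ?P c = c \<oplus>\<oplus> (\<lambda>k. holds C t (k - n - 2))"
    by (auto simp: xor_track_def)
  then show ?thesis
    unfolding pulse_gate_def cond_gate_def code_gate_def case_prod_conv holds_shift c_def[symmetric]
    by (auto simp: c_def xor_track_def fun_eq_iff)
qed

section \<open>Simultaneous action on families of pairs\<close>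

definition reach :: "'i set \<Rightarrow> ('i \<Rightarrow> track) \<Rightarrow> ('i \<Rightarrow> track) \<Rightarrow> ('i \<Rightarrow> track) \<Rightarrow> ('i \<Rightarrow> track) \<Rightarrow> bool" where
  "reach I T B T' B' \<longleftrightarrow> (\<exists>g\<in>gate_group. \<forall>i\<in>I. g (T i, B i) = (T' i, B' i))"

lemma reach_refl: "(\<And>i. i \<in> I \<Longrightarrow> T i = T' i \<and> B i = B' i) \<Longrightarrow> reach I T B T' B'"
  unfolding reach_def using gate_group_id by (intro bexI[of _ id]) auto

lemma reach_trans [trans]:
  assumes "reach I T B T' B'" "reach I T' B' T'' B''"
  shows "reach I T B T'' B''"
proof -
  obtain g h where "g \<in> gate_group" "h \<in> gate_group" "\<forall>i\<in>I. g (T i, B i) = (T' i, B' i)" "\<forall>i\<in>I. h (T' i, B' i) = (T'' i, B'' i)"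
    using assms unfolding reach_def by blast
  then show ?thesis unfolding reach_def by (intro bexI[of _ "h \<circ> g"] gate_group_comp) auto
qed

lemma reach_sym:
  assumes "reach I T B T' B'"
  shows "reach I T' B' T B"
proof -
  obtain g where "g \<in> gate_group" "\<forall>i\<in>I. g (T i, B i) = (T' i, B' i)"
    using assms unfolding reach_def by blast
  moreover obtain h where "h \<in> gate_group" "\<And>x. h (g x) = x" using gate_group_inv[OF \<open>g \<in> gate_group\<close>] by blast
  ultimately show ?thesis unfolding reach_def by metis
qed

text \<open>The group is closed under exchange of the tracks, so every result about altering the
  second tracks also applies to the first.\<close>

lemma reach_swap: "reach I T B T' B' \<longleftrightarrow> reach I B T B' T'"
proof -
  have "reach I B T B' T'" if "reach I T B T' B'" for T B T' B' :: "'a \<Rightarrow> track"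
  proof -
    obtain g where "g \<in> gate_group" "\<forall>i\<in>I. g (T i, B i) = (T' i, B' i)"
      using \<open>reach I T B T' B'\<close> unfolding reach_def by blast
    then show ?thesis unfolding reach_def
      by (intro bexI[of _ "swapped g"] swapped_gate_group) (auto simp: swapped_def)
  qed
  then show ?thesis by blast
qed

text \<open>The conditions select, in each translate of \<open>u\<close>, the single place
  corresponding to a lead \<open>p\<close> of \<open>u\<close>; tracks in other orbits trigger
  nothing.\<close>

lemma reach_add:
  assumes I: "finite I" "\<And>i. i \<in> I \<Longrightarrow> finite_track (T i)" and u: "finite_track u" "nonzero_track u"
    and clean: "\<And>i q k. i \<in> I \<Longrightarrow> T i = translate q u \<Longrightarrow> k \<in> {n + q - 4..n + q + 2} \<Longrightarrow> \<not> B i k"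
  shows "reach I T B T (\<lambda>i k. B i k \<noteq> (T i = translate (k - n) u))"
proof -
  obtain p where p: "lead u p" using finite_track_lead_nonzero_track[OF u] .
  obtain C where C: "finite C" "\<And>t q. t \<in> T ` I \<Longrightarrow> holds C t q \<longleftrightarrow> t = translate (q - p) u"
    using detector[of "T ` I" u p] I u p by blast
  \<comment> \<open>A copy \<open>translate q u\<close> is detected at \<open>q + p\<close>, and the
    new bit lands two cells after the start of the pulse; this offset compensates both, so the bit
    falls on \<open>n + q\<close>.\<close>
  let ?n = "n - p - 2"
  let ?K = "cond_gate ((\<lambda>(a, e). (a - ?n, e)) ` C)"
  have "pulse_gate ?n (?K (pulse_gate ?n (T i, B i))) = (T i, \<lambda>k. B i k \<noteq> (T i = translate (k - n) u))"
    if "i \<in> I" for i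
  proof -
    have h: "holds C (T i) q \<longleftrightarrow> T i = translate (q - p) u" for q using C that by blast
    have "pulse_gate ?n (?K (pulse_gate ?n (T i, B i))) = (T i, \<lambda>k. B i k \<noteq> holds C (T i) (k - ?n - 2))"
    proof (rule pulse_cond_pulse)
      fix q assume "holds C (T i) q"
      then have q: "T i = translate (q - p) u" using h by simp
      then have "lead (T i) q" using p by (simp add: lead_translate) (simp add: translate_def)
      then show "lead (T i) q \<and> (\<forall>k\<in>{?n + q - 2..?n + q + 4}. \<not> B i k)"
        using clean[OF that q] by auto
    qed
    then show ?thesis by (simp add: h algebra_simps)
  qed
  moreover have "pulse_gate ?n \<circ> ?K \<circ> pulse_gate ?n \<in> gate_group"
    by (intro gate_group_comp pulse_gate_gate_group cond_gate_gate_group) (simp add: C)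
  ultimately show ?thesis unfolding reach_def
    by (intro bexI[of _ "pulse_gate ?n \<circ> ?K \<circ> pulse_gate ?n"] ballI) simp_all
qed

text \<open>For large \<open>n\<close> the leftmost ones of the two sums come from \<open>B\<close>
  and \<open>B'\<close>, which bounds \<open>q\<close>. Then only \<open>B\<close> and
  \<open>B'\<close> are visible near the origin, and only \<open>F\<close> and \<open>F'\<close>
  around \<open>n\<close>.\<close>

lemma sep:
  assumes f: "finite_track B" "finite_track B'" "finite_track F" "finite_track F'" and nonzero_track: "nonzero_track B" "nonzero_track B'"
  shows "\<forall>\<^sub>F n in at_top. \<forall>q. translate q (B \<oplus>\<oplus> translate n F) = B' \<oplus>\<oplus> translate n F' \<longrightarrow> translate q B = B' \<and> translate q F = F'"
proof -
  obtain R1 where R1: "\<And>i. B i \<Longrightarrow> \<bar>i\<bar> \<le> R1" using finite_track_bound[OF f(1)] by blast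
  obtain R2 where R2: "\<And>i. B' i \<Longrightarrow> \<bar>i\<bar> \<le> R2" using finite_track_bound[OF f(2)] by blast
  obtain R3 where R3: "\<And>i. F i \<Longrightarrow> \<bar>i\<bar> \<le> R3" using finite_track_bound[OF f(3)] by blast
  obtain R4 where R4: "\<And>i. F' i \<Longrightarrow> \<bar>i\<bar> \<le> R4" using finite_track_bound[OF f(4)] by blast
  define R where "R = \<bar>R1\<bar> + \<bar>R2\<bar> + \<bar>R3\<bar> + \<bar>R4\<bar>"
  have out: "\<not> B i" "\<not> B' i" "\<not> F i" "\<not> F' i" if "\<bar>i\<bar> > R" for i
    using R1[of i] R2[of i] R3[of i] R4[of i] that by (auto simp: R_def)
  have "R \<ge> 0" by (simp add: R_def)
  obtain a where a: "B a" "\<And>i. B i \<Longrightarrow> a \<le> i" using finite_track_least[OF f(1) nonzero_track(1)] by blast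
  obtain a' where a': "B' a'" "\<And>i. B' i \<Longrightarrow> a' \<le> i" using finite_track_least[OF f(2) nonzero_track(2)] by blast
  have aR: "\<bar>a\<bar> \<le> R" "\<bar>a'\<bar> \<le> R" using a a' out(1)[of a] out(2)[of a'] by force+
  \<comment> \<open>The bound \<open>10 * R + 1\<close> leaves room for \<open>q\<close> up to
    \<open>2 * R\<close> in absolute value and for the threshold \<open>3 * R\<close> that separates
    the two supports.\<close>
  have "translate q B = B' \<and> translate q F = F'"
    if n: "n \<ge> 10 * R + 1" and eq: "translate q (B \<oplus>\<oplus> translate n F) = B' \<oplus>\<oplus> translate n F'" for n q
  proof -
    have e: "(B (k - q) \<noteq> F (k - q - n)) = (B' k \<noteq> F' (k - n))" for k
      using eq by (simp add: translate_def xor_track_def fun_eq_iff)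
    have "a' \<ge> a + q"
    proof -
      have "\<not> F' (a' - n)" by (rule out) (use aR n in auto)
      then consider "B (a' - q)" | "F (a' - q - n)" using e[of a'] a'(1) by auto
      then show ?thesis
      proof cases
        case 1 then show ?thesis using a(2) by force
      next
        case 2
        then have "\<bar>a' - q - n\<bar> \<le> R" using out(3) by force
        then show ?thesis using aR n by auto
      qed
    qed
    moreover have "a + q \<ge> a'"
    proof -
      have "\<not> F (a - n)" by (rule out) (use aR n in auto)
      then consider "B' (a + q)" | "F' (a + q - n)" using e[of "a + q"] a(1) by auto
      then show ?thesis
      proof cases
        case 1 then show ?thesis using a'(2) by force
      next
        case 2
        then have "\<bar>a + q - n\<bar> \<le> R" using out(4) by force
        then show ?thesis using aR n by auto
      qed
    qed
    ultimately have q: "\<bar>q\<bar> \<le> 2 * R" using aR by auto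
    have "B (k - q) = B' k" for k
    proof (cases "\<bar>k\<bar> \<le> 3 * R")
      case True
      then have "\<not> F (k - q - n)" "\<not> F' (k - n)" using q n by (auto intro!: out)
      then show ?thesis using e[of k] by auto
    next
      case False
      then have "\<not> B (k - q)" "\<not> B' k" using q \<open>R \<ge> 0\<close> by (auto intro!: out)
      then show ?thesis by auto
    qed
    moreover have "F (k - q) = F' k" for k
    proof (cases "\<bar>k\<bar> \<le> 3 * R")
      case True
      then have "\<not> B (k + n - q)" "\<not> B' (k + n)" using q n \<open>R \<ge> 0\<close> by (auto intro!: out)
      then show ?thesis using e[of "k + n"] by (auto simp: algebra_simps)
    next
      case False
      then have "\<not> F (k - q)" "\<not> F' k" using q \<open>R \<ge> 0\<close> by (auto intro!: out)
      then show ?thesis by auto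
    qed
    ultimately show ?thesis by (auto simp: translate_def)
  qed
  then show ?thesis unfolding eventually_at_top_linorder by blast
qed

section \<open>Families of pairs in general position\<close>

lemma far_right:
  assumes "finite_track b"
  shows "\<forall>\<^sub>F n in at_top. \<forall>k\<ge>n - c. \<not> b k"
proof -
  obtain R where R: "\<forall>i. b i \<longrightarrow> \<bar>i\<bar> \<le> R" using finite_track_bound[OF assms] by blast
  have "\<not> b k" if "n \<ge> R + c + 1" "k \<ge> n - c" for n k using R[rule_format, of k] that by auto
  then show ?thesis unfolding eventually_at_top_linorder by blast
qed

lemma far_left:
  assumes "finite_track b"
  shows "\<forall>\<^sub>F n in at_top. \<forall>k\<le>c - n. \<not> b k"
proof -
  obtain R where R: "\<forall>i. b i \<longrightarrow> \<bar>i\<bar> \<le> R" using finite_track_bound[OF assms] by blast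
  have "\<not> b k" if "n \<ge> R + c + 1" "k \<le> c - n" for n k using R[rule_format, of k] that by auto
  then show ?thesis unfolding eventually_at_top_linorder by blast
qed

lemma eventually_nonzero_track_xor_left:
  assumes "nonzero_track b" "finite_track f"
  shows "\<forall>\<^sub>F n in at_top. nonzero_track (b \<oplus>\<oplus> translate n f)"
proof -
  obtain m where m: "b m" using assms(1) by (auto simp: nonzero_track_def)
  have "\<forall>\<^sub>F n in at_top. \<forall>k\<le>m - n. \<not> f k" by (rule far_left[OF assms(2)])
  then show ?thesis
    by (rule eventually_mono) (use m in \<open>auto simp: nonzero_track_def xor_track_def translate_def intro!: exI[of _ m]\<close>)
qed

lemma eventually_nonzero_track_xor_right:
  assumes "nonzero_track f" "finite_track b"
  shows "\<forall>\<^sub>F n in at_top. nonzero_track (b \<oplus>\<oplus> translate n f)"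
proof -
  obtain m where m: "f m" using assms(1) by (auto simp: nonzero_track_def)
  have "\<forall>\<^sub>F n in at_top. \<forall>k\<ge>n - (- m). \<not> b k" by (rule far_right[OF assms(2)])
  then show ?thesis
  proof (rule eventually_mono)
    fix n assume "\<forall>k\<ge>n - (- m). \<not> b k"
    then have "\<not> b (m + n)" by simp
    then show "nonzero_track (b \<oplus>\<oplus> translate n f)" using m by (auto simp: nonzero_track_def xor_track_def translate_def intro!: exI[of _ "m + n"])
  qed
qed

definition pairwise_inequiv :: "'i set \<Rightarrow> ('i \<Rightarrow> track) \<Rightarrow> ('i \<Rightarrow> track) \<Rightarrow> bool" where
  "pairwise_inequiv I T B \<longleftrightarrow>
     (\<forall>i\<in>I. \<forall>l\<in>I. i \<noteq> l \<longrightarrow> (\<forall>q. \<not> (T l = translate q (T i) \<and> B l = translate q (B i))))"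

text \<open>Stronger than inequivalence of the pairs: the tracks of one family alone lie in
  different translation orbits, so each index can be recognised by that track.\<close>

definition generic :: "'i set \<Rightarrow> ('i \<Rightarrow> track) \<Rightarrow> bool" where
  "generic I B \<longleftrightarrow> (\<forall>i\<in>I. finite_track (B i) \<and> nonzero_track (B i)) \<and>
     (\<forall>i\<in>I. \<forall>l\<in>I. i \<noteq> l \<longrightarrow> (\<forall>q. B l \<noteq> translate q (B i)))"

text \<open>Elements of the group commute with translations and are injective.\<close>

lemma reach_pairwise_inequiv:
  assumes "reach I T B T' B'" "pairwise_inequiv I T B"
  shows "pairwise_inequiv I T' B'"
  unfolding pairwise_inequiv_def
proof (intro ballI impI allI notI)
  fix i l q assume il: "i \<in> I" "l \<in> I" "i \<noteq> l" and eq: "T' l = translate q (T' i) \<and> B' l = translate q (B' i)"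
  obtain g where g: "g \<in> gate_group" "\<forall>i\<in>I. g (T i, B i) = (T' i, B' i)"
    using assms(1) unfolding reach_def by blast
  obtain h where h: "\<And>x. h (g x) = x" using gate_group_inv[OF g(1)] by blast
  have "g (T l, B l) = translate_pair q (g (T i, B i))"
    using g(2) il eq by (simp add: translate_pair_def)
  also have "\<dots> = g (translate_pair q (T i, B i))"
    using gate_group_automorphism[OF g(1)] by (simp add: automorphism_def equivariant_def del: split_paired_All)
  finally have "(T l, B l) = translate_pair q (T i, B i)" using h by metis
  then show False using assms(2) il by (auto simp: pairwise_inequiv_def translate_pair_def)
qed

text \<open>Each \<open>T i\<close> allows at most one \<open>q\<close>, so for each index a single
  window, moving right with \<open>n\<close>, has to leave the support of
  \<open>B i\<close>.\<close>

lemma eventually_clean: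
  assumes "finite I" "\<And>i. i \<in> I \<Longrightarrow> finite_track (B i)" "finite_track u" "nonzero_track u"
  shows "\<forall>\<^sub>F n in at_top. \<forall>i\<in>I. \<forall>q. T i = translate q u \<longrightarrow> (\<forall>k\<in>{n + q - 4..n + q + 2}. \<not> B i k)"
proof (rule eventually_ball_finite[OF assms(1)], intro ballI)
  fix i assume "i \<in> I"
  show "\<forall>\<^sub>F n in at_top. \<forall>q. T i = translate q u \<longrightarrow> (\<forall>k\<in>{n + q - 4..n + q + 2}. \<not> B i k)"
  proof (cases "\<exists>q. T i = translate q u")
    case True
    then obtain q where q: "T i = translate q u" by blast
    have "\<forall>\<^sub>F n in at_top. \<forall>k\<ge>n - (4 - q). \<not> B i k"
      using assms(2)[OF \<open>i \<in> I\<close>] by (rule far_right)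
    then show ?thesis
    proof (rule eventually_mono, intro allI impI ballI)
      fix n q' k assume n: "\<forall>k\<ge>n - (4 - q). \<not> B i k" and "T i = translate q' u" "k \<in> {n + q' - 4..n + q' + 2}"
      then have "q' = q" using q translate_unique[OF assms(3,4)] by metis
      then show "\<not> B i k" using n \<open>k \<in> _\<close> by auto
    qed
  qed simp
qed

lemma eventually_sep_family:
  assumes "finite I" "\<And>i. i \<in> I \<Longrightarrow> finite_track (B i) \<and> nonzero_track (B i) \<and> finite_track (F i)"
  shows "\<forall>\<^sub>F n in at_top. (\<forall>i\<in>I. nonzero_track (B i \<oplus>\<oplus> translate n (F i))) \<and> (\<forall>i\<in>I. \<forall>l\<in>I. \<forall>q.
    translate q (B i \<oplus>\<oplus> translate n (F i)) = B l \<oplus>\<oplus> translate n (F l) \<longrightarrow> translate q (B i) = B l \<and> translate q (F i) = F l)"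
  using assms by (intro eventually_conj eventually_ball_finite ballI eventually_nonzero_track_xor_left sep) auto

lemma eventually_generic:
  assumes "finite I" "generic I B" "\<And>i. i \<in> I \<Longrightarrow> finite_track (F i)"
  shows "\<forall>\<^sub>F n in at_top. generic I (\<lambda>i. B i \<oplus>\<oplus> translate n (F i))"
proof -
  have "\<forall>\<^sub>F n in at_top. (\<forall>i\<in>I. nonzero_track (B i \<oplus>\<oplus> translate n (F i))) \<and> (\<forall>i\<in>I. \<forall>l\<in>I. \<forall>q.
    translate q (B i \<oplus>\<oplus> translate n (F i)) = B l \<oplus>\<oplus> translate n (F l) \<longrightarrow> translate q (B i) = B l \<and> translate q (F i) = F l)"
    by (rule eventually_sep_family) (use assms in \<open>auto simp: generic_def\<close>)
  then show ?thesis
  proof (rule eventually_mono)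
    fix n assume n: "(\<forall>i\<in>I. nonzero_track (B i \<oplus>\<oplus> translate n (F i))) \<and> (\<forall>i\<in>I. \<forall>l\<in>I. \<forall>q.
      translate q (B i \<oplus>\<oplus> translate n (F i)) = B l \<oplus>\<oplus> translate n (F l) \<longrightarrow> translate q (B i) = B l \<and> translate q (F i) = F l)"
    then show "generic I (\<lambda>i. B i \<oplus>\<oplus> translate n (F i))"
      using assms unfolding generic_def by (metis finite_track_xor finite_track_translate)
  qed
qed

lemma eventually_at_top_int_ex: "\<forall>\<^sub>F n :: int in at_top. P n \<Longrightarrow> \<exists>n. P n"
  unfolding eventually_at_top_linorder by blast

text \<open>Induction on the number of pairs of indices whose second tracks are translates of each
  other. For such a pair \<open>(j, l)\<close>, one far bit is added to each \<open>B i\<close>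
  whose \<open>T i\<close> is a translate of \<open>T j\<close>. This separates \<open>j\<close>
  from \<open>l\<close>, and by \<open>sep\<close> it creates no new bad pair.\<close>

lemma make_generic:
  assumes I: "finite I" and T: "\<And>i. i \<in> I \<Longrightarrow> finite_track (T i) \<and> nonzero_track (T i)"
    and "\<And>i. i \<in> I \<Longrightarrow> finite_track (B i) \<and> nonzero_track (B i)" and "pairwise_inequiv I T B"
  shows "\<exists>B'. reach I T B T B' \<and> generic I B'"
  using assms(3-)
proof (induction "card {(i, l) \<in> I \<times> I. i \<noteq> l \<and> (\<exists>q. B l = translate q (B i))}" arbitrary: B rule: less_induct)
  case less
  define bad where "bad = (\<lambda>B :: 'a \<Rightarrow> track. {(i, l) \<in> I \<times> I. i \<noteq> l \<and> (\<exists>q. B l = translate q (B i))})"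
  have fbad: "finite (bad B)" for B
    by (rule finite_subset[of _ "I \<times> I"]) (use I in \<open>auto simp: bad_def\<close>)
  show ?case
  proof (cases "bad B = {}")
    case True
    then have "generic I B" using less.prems(1) unfolding generic_def bad_def by blast
    then show ?thesis using reach_refl[of I T T B B] by blast
  next
    case False
    then obtain j l where jl: "(j, l) \<in> bad B" by auto
    then have j: "j \<in> I" "l \<in> I" "j \<noteq> l" by (auto simp: bad_def)
    \<comment> \<open>\<open>F i\<close> is the single bit at the \<open>q\<close> with
      \<open>T i = translate q (T j)\<close>, or zero if there is no such \<open>q\<close>.\<close>
    define F where "F = (\<lambda>i k. T i = translate k (T j))"
    have F: "finite_track (F i)" if "i \<in> I" for i
    proof -
      have "{k. F i k} \<subseteq> {THE k. F i k}"
        using T[OF j(1)] translate_unique[of "T j"] by (auto simp: F_def intro: the_equality[symmetric])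
      then show ?thesis unfolding finite_track_def using finite_subset by blast
    qed
    have ev1: "\<forall>\<^sub>F n in at_top. \<forall>i\<in>I. \<forall>q. T i = translate q (T j) \<longrightarrow> (\<forall>k\<in>{n + q - 4..n + q + 2}. \<not> B i k)"
      using I less.prems T j by (intro eventually_clean) auto
    have ev2: "\<forall>\<^sub>F n in at_top. (\<forall>i\<in>I. nonzero_track (B i \<oplus>\<oplus> translate n (F i))) \<and> (\<forall>i\<in>I. \<forall>l\<in>I. \<forall>q.
        translate q (B i \<oplus>\<oplus> translate n (F i)) = B l \<oplus>\<oplus> translate n (F l) \<longrightarrow> translate q (B i) = B l \<and> translate q (F i) = F l)"
      using I less.prems F by (intro eventually_sep_family) auto
    obtain n where n: "\<forall>i\<in>I. \<forall>q. T i = translate q (T j) \<longrightarrow> (\<forall>k\<in>{n + q - 4..n + q + 2}. \<not> B i k)"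
      "\<forall>i\<in>I. nonzero_track (B i \<oplus>\<oplus> translate n (F i))"
      "\<forall>i\<in>I. \<forall>l\<in>I. \<forall>q. translate q (B i \<oplus>\<oplus> translate n (F i)) = B l \<oplus>\<oplus> translate n (F l) \<longrightarrow>
        translate q (B i) = B l \<and> translate q (F i) = F l"
      using eventually_at_top_int_ex[OF eventually_conj[OF ev1 ev2]] by blast
    have clean: "\<And>i q k. i \<in> I \<Longrightarrow> T i = translate q (T j) \<Longrightarrow> k \<in> {n + q - 4..n + q + 2} \<Longrightarrow> \<not> B i k"
      using n(1) by blast
    have nonzero_track: "\<And>i. i \<in> I \<Longrightarrow> nonzero_track (B i \<oplus>\<oplus> translate n (F i))" using n(2) by blast
    have sep: "\<And>i l q. i \<in> I \<Longrightarrow> l \<in> I \<Longrightarrow> translate q (B i \<oplus>\<oplus> translate n (F i)) = B l \<oplus>\<oplus> translate n (F l) \<Longrightarrow>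
        translate q (B i) = B l \<and> translate q (F i) = F l"
      using n(3) by blast
    define B1 where "B1 = (\<lambda>i. B i \<oplus>\<oplus> translate n (F i))"
    have "reach I T B T (\<lambda>i k. B i k \<noteq> (T i = translate (k - n) (T j)))"
      by (rule reach_add[OF I]) (use T j clean in auto)
    then have r: "reach I T B T B1" by (simp add: B1_def F_def xor_track_def translate_def)
    have "bad B1 \<subseteq> bad B"
    proof
      fix z assume "z \<in> bad B1"
      then obtain i l' q where z: "z = (i, l')" "i \<in> I" "l' \<in> I" "i \<noteq> l'" and "B1 l' = translate q (B1 i)"
        by (auto simp: bad_def)
      then have "B l' = translate q (B i)" using sep[of i l' q] by (simp add: B1_def)
      then show "z \<in> bad B" using z by (auto simp: bad_def)
    qed
    moreover have "(j, l) \<notin> bad B1"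
    proof
      assume "(j, l) \<in> bad B1"
      then obtain q where "translate q (B1 j) = B1 l" by (auto simp: bad_def)
      then have q: "translate q (B j) = B l" "translate q (F j) = F l" using sep[OF j(1,2)] by (simp_all add: B1_def)
      \<comment> \<open>\<open>F j\<close> has its bit at 0, so \<open>F l\<close> has its bit at
        \<open>q\<close>. This relates \<open>T l\<close> to \<open>T j\<close> by the same
        \<open>q\<close> that relates \<open>B l\<close> to \<open>B j\<close>.\<close>
      have "translate q (F j) q" by (simp add: translate_def[of q] F_def)
      then have "T l = translate q (T j)" using q(2) by (simp add: F_def)
      then show False using less.prems(2)[unfolded pairwise_inequiv_def] q(1) j by metis
    qed
    ultimately have "bad B1 \<subset> bad B" using jl by blast
    then have "card (bad B1) < card (bad B)" using fbad by (intro psubset_card_mono)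
    moreover have "finite_track (B1 i) \<and> nonzero_track (B1 i)" if "i \<in> I" for i
      using nonzero_track[OF that] F[OF that] less.prems(1)[OF that] by (simp add: B1_def finite_track_xor)
    moreover have "pairwise_inequiv I T B1" using reach_pairwise_inequiv[OF r less.prems(2)] .
    ultimately obtain B' where "reach I T B1 T B'" "generic I B'"
      using less.hyps[of B1] unfolding bad_def by blast
    then show ?thesis using reach_trans[OF r] by blast
  qed
qed

section \<open>Making all tracks nonzero and generic\<close>

definition pulses :: "track \<Rightarrow> track" where
  "pulses t = lead t \<oplus>\<oplus> translate 1 (lead t)"

lemma reach_pulses: "reach I T B T (\<lambda>i. B i \<oplus>\<oplus> translate n (pulses (T i)))"
  unfolding reach_def using pulse_gate_gate_group[of n]
  by (auto simp: pulse_gate_def pulses_def translate_xor intro!: bexI[of _ "pulse_gate n"])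

lemma finite_track_pulses: "finite_track t \<Longrightarrow> finite_track (pulses t)"
  by (simp add: pulses_def finite_track_xor finite_track_lead)

lemma nonzero_track_pulses:
  assumes "finite_track t" "nonzero_track t"
  shows "nonzero_track (pulses t)"
proof -
  obtain p where "lead t p" "\<not> lead t (p - 1)" using finite_track_lead_nonzero_track[OF assms] .
  then show ?thesis by (auto simp: nonzero_track_def pulses_def xor_track_def translate_def intro!: exI[of _ p])
qed

text \<open>Far pulses do not erase a nonzero \<open>B i\<close>, and they make \<open>B i\<close>
  nonzero whenever \<open>T i\<close> is; one large \<open>n\<close> serves all indices.\<close>

lemma make_nonzero_track:
  assumes "finite I" "\<And>i. i \<in> I \<Longrightarrow> finite_track (T i) \<and> finite_track (B i)" "\<And>i. i \<in> I \<Longrightarrow> nonzero_track (T i) \<or> nonzero_track (B i)"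
  shows "\<exists>B'. reach I T B T B' \<and> (\<forall>i\<in>I. finite_track (B' i) \<and> nonzero_track (B' i))"
proof -
  have "\<forall>\<^sub>F n in at_top. \<forall>i\<in>I. nonzero_track (B i \<oplus>\<oplus> translate n (pulses (T i)))"
  proof (rule eventually_ball_finite[OF assms(1)], intro ballI)
    fix i assume "i \<in> I"
    then show "\<forall>\<^sub>F n in at_top. nonzero_track (B i \<oplus>\<oplus> translate n (pulses (T i)))"
      using assms(2,3)[of i] eventually_nonzero_track_xor_left[of "B i" "pulses (T i)"]
        eventually_nonzero_track_xor_right[of "pulses (T i)" "B i"] finite_track_pulses nonzero_track_pulses by blast
  qed
  then obtain n where "\<forall>i\<in>I. nonzero_track (B i \<oplus>\<oplus> translate n (pulses (T i)))"
    using eventually_at_top_int_ex by blast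
  then show ?thesis
    using reach_pulses[of I T B n] assms(2) finite_track_xor finite_track_pulses finite_track_translate by blast
qed

text \<open>First all \<open>B i\<close>, then all \<open>T i\<close> become nonzero. Afterwards
  \<open>make_generic\<close> separates the \<open>B i\<close> by means of the \<open>T i\<close>,
  and then the \<open>T i\<close> by means of the \<open>B i\<close>.\<close>

lemma make_generic_pair:
  assumes I: "finite I" and "\<And>i. i \<in> I \<Longrightarrow> finite_track (T i) \<and> finite_track (B i)" "\<And>i. i \<in> I \<Longrightarrow> nonzero_track (T i) \<or> nonzero_track (B i)"
    "pairwise_inequiv I T B"
  shows "\<exists>T' B'. reach I T B T' B' \<and> generic I T' \<and> generic I B'"
proof -
  have "\<exists>B'. reach I T B T B' \<and> (\<forall>i\<in>I. finite_track (B' i) \<and> nonzero_track (B' i))"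
    by (rule make_nonzero_track[OF I assms(2,3)])
  then obtain B1 where B1: "reach I T B T B1" "\<And>i. i \<in> I \<Longrightarrow> finite_track (B1 i) \<and> nonzero_track (B1 i)" by blast
  have "\<exists>T1. reach I B1 T B1 T1 \<and> (\<forall>i\<in>I. finite_track (T1 i) \<and> nonzero_track (T1 i))"
    by (rule make_nonzero_track[OF I]) (use assms(2) B1(2) in auto)
  then obtain T1 where T1: "reach I B1 T B1 T1" "\<And>i. i \<in> I \<Longrightarrow> finite_track (T1 i) \<and> nonzero_track (T1 i)" by blast
  have r: "reach I T B T1 B1" by (rule reach_trans[OF B1(1) T1(1)[unfolded reach_swap[of I B1]]])
  have ineq: "pairwise_inequiv I T1 B1" by (rule reach_pairwise_inequiv[OF r assms(4)])
  obtain B2 where B2: "reach I T1 B1 T1 B2" "generic I B2"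
    using make_generic[OF I T1(2) B1(2) ineq] by blast
  have "pairwise_inequiv I T1 B2" by (rule reach_pairwise_inequiv[OF B2(1) ineq])
  then have ineq': "pairwise_inequiv I B2 T1" unfolding pairwise_inequiv_def by blast
  have "\<exists>T2. reach I B2 T1 B2 T2 \<and> generic I T2"
    by (rule make_generic[OF I _ T1(2) ineq']) (use B2(2) in \<open>auto simp: generic_def\<close>)
  then obtain T2 where T2: "reach I B2 T1 B2 T2" "generic I T2" by blast
  have "reach I T B T2 B2"
    by (rule reach_trans[OF reach_trans[OF r B2(1)] T2(1)[unfolded reach_swap[of I B2]]])
  then show ?thesis using T2(2) B2(2) by blast
qed

section \<open>Even patterns carried by a far bit\<close>

definition point :: "int \<Rightarrow> track" where
  "point m = (\<lambda>k. k = m)"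

lemma translate_point [simp]: "translate q (point m) = point (m + q)"
  by (auto simp: point_def translate_def)

lemma finite_track_point [simp]: "finite_track (point m)"
  by (simp add: point_def finite_track_def)

text \<open>\<open>f\<close> assigns to each track a pattern that the group can add to
  \<open>b\<close> at any offset. A bit placed far to the left on \<open>t\<close> contributes a
  copy of \<open>e\<close> there, whatever the finite track \<open>t\<close> is.\<close>

definition carries :: "track \<Rightarrow> (track \<Rightarrow> track) \<Rightarrow> bool" where
  "carries e f \<longleftrightarrow> (\<forall>t. finite_track t \<longrightarrow> finite_track (f t)) \<and> (\<forall>n. (\<lambda>(t, b). (t, b \<oplus>\<oplus> translate n (f t))) \<in> gate_group) \<and>
     (\<forall>t. finite_track t \<longrightarrow> (\<forall>\<^sub>F m in at_top. f (t \<oplus>\<oplus> point (- m)) = f t \<oplus>\<oplus> translate (- m) e))"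

lemma carries_xor:
  assumes "carries e f" "carries e' f'"
  shows "carries (e \<oplus>\<oplus> e') (\<lambda>t. f t \<oplus>\<oplus> f' t)"
  unfolding carries_def
proof (intro conjI allI impI)
  show "finite_track (f t \<oplus>\<oplus> f' t)" if "finite_track t" for t using assms that finite_track_xor by (auto simp: carries_def)
  show "(\<lambda>(t, b). (t, b \<oplus>\<oplus> translate n (f t \<oplus>\<oplus> f' t))) \<in> gate_group" for n
  proof -
    have "(\<lambda>(t, b). (t, b \<oplus>\<oplus> translate n (f t))) \<circ> (\<lambda>(t, b). (t, b \<oplus>\<oplus> translate n (f' t))) \<in> gate_group"
      using assms by (intro gate_group_comp) (auto simp: carries_def)
    moreover have "(\<lambda>(t, b). (t, b \<oplus>\<oplus> translate n (f t))) \<circ> (\<lambda>(t, b). (t, b \<oplus>\<oplus> translate n (f' t))) =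
      (\<lambda>(t, b). (t, b \<oplus>\<oplus> translate n (f t \<oplus>\<oplus> f' t)))"
      by (rule ext) (auto simp: xor_track_def translate_def)
    ultimately show ?thesis by simp
  qed
  fix t assume "finite_track t"
  then have "\<forall>\<^sub>F m in at_top. f (t \<oplus>\<oplus> point (- m)) = f t \<oplus>\<oplus> translate (- m) e"
    "\<forall>\<^sub>F m in at_top. f' (t \<oplus>\<oplus> point (- m)) = f' t \<oplus>\<oplus> translate (- m) e'"
    using assms by (auto simp: carries_def)
  then show "\<forall>\<^sub>F m in at_top. f (t \<oplus>\<oplus> point (- m)) \<oplus>\<oplus> f' (t \<oplus>\<oplus> point (- m)) = f t \<oplus>\<oplus> f' t \<oplus>\<oplus> translate (- m) (e \<oplus>\<oplus> e')"
    by eventually_elim (auto simp: xor_track_def translate_def)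
qed

text \<open>A bit far to the left of the support is itself a lead, and it is too distant to spoil
  the four zeros before any other lead.\<close>

lemma lead_far_point:
  assumes "finite_track t"
  shows "\<forall>\<^sub>F m in at_top. lead (t \<oplus>\<oplus> point (- m)) = lead t \<oplus>\<oplus> point (- m)"
  using far_left[OF assms, of 4]
proof (rule eventually_mono)
  fix m assume m: "\<forall>k\<le>4 - m. \<not> t k"
  have "lead (t \<oplus>\<oplus> point (- m)) i = (lead t \<oplus>\<oplus> point (- m)) i" for i
  proof (cases "i \<le> 4 - m")
    case True
    then show ?thesis using m by (auto simp: lead_def xor_track_def point_def)
  next
    case False
    then show ?thesis by (auto simp: lead_def xor_track_def point_def)
  qed
  then show "lead (t \<oplus>\<oplus> point (- m)) = lead t \<oplus>\<oplus> point (- m)" by blast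
qed

lemma carries_adjacent: "carries (point k \<oplus>\<oplus> point (k + 1)) (\<lambda>t. translate k (pulses t))"
  unfolding carries_def
proof (intro conjI allI impI)
  show "(\<lambda>(t, b). (t, b \<oplus>\<oplus> translate n (translate k (pulses t)))) \<in> gate_group" for n
    using pulse_gate_gate_group[of "n + k"] by (simp add: pulse_gate_def pulses_def translate_xor add.assoc)
  show "\<forall>\<^sub>F m in at_top. translate k (pulses (t \<oplus>\<oplus> point (- m))) = translate k (pulses t) \<oplus>\<oplus> translate (- m) (point k \<oplus>\<oplus> point (k + 1))"
    if "finite_track t" for t
    using lead_far_point[OF that]
  proof eventually_elim
    case (elim m)
    then show ?case by (simp add: pulses_def translate_xor) (auto simp: xor_track_def algebra_simps)
  qed
qed (simp add: finite_track_pulses)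

text \<open>Adjacent pairs telescope to any two points.\<close>

lemma carries_two:
  assumes "k < l"
  shows "\<exists>f. carries (point k \<oplus>\<oplus> point l) f"
  using assms
proof (induction l rule: int_gr_induct)
  case base
  then show ?case using carries_adjacent by blast
next
  case (step l)
  then obtain f where "carries (point k \<oplus>\<oplus> point l) f" by blast
  from carries_xor[OF this carries_adjacent[of l]] have "carries (point k \<oplus>\<oplus> point l \<oplus>\<oplus> (point l \<oplus>\<oplus> point (l + 1))) (\<lambda>t. f t \<oplus>\<oplus> translate l (pulses t))" .
  moreover have "point k \<oplus>\<oplus> point l \<oplus>\<oplus> (point l \<oplus>\<oplus> point (l + 1)) = point k \<oplus>\<oplus> point (l + 1)"
    by (auto simp: xor_track_def)
  ultimately show ?case by auto
qed

text \<open>Two points are removed at a time until the pattern is empty; evenness guarantees the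
  second point.\<close>

lemma carries_even:
  assumes "finite_track e" "even (card {i. e i})"
  shows "\<exists>f. carries e f"
  using assms
proof (induction "card {i. e i}" arbitrary: e rule: less_induct)
  case less
  have fe: "finite {i. e i}" using less.prems by (simp add: finite_track_def)
  show ?case
  proof (cases "nonzero_track e")
    case False
    then have e: "e = (\<lambda>_. False)" by (auto simp: nonzero_track_def)
    have "carries e (\<lambda>_. e)"
      unfolding carries_def
    proof (intro conjI allI impI)
      have "(\<lambda>(t, b). (t, b \<oplus>\<oplus> translate n e)) = id" for n
        by (auto simp: e fun_eq_iff xor_track_def translate_def)
      then show "(\<lambda>(t, b). (t, b \<oplus>\<oplus> translate n e)) \<in> gate_group" for n using gate_group_id by metis
    qed (auto simp: e finite_track_def xor_track_def translate_def)
    then show ?thesis by blast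
  next
    case True
    then obtain k where k: "e k" by (auto simp: nonzero_track_def)
    have "{i. e i} \<noteq> {k}" using less.prems(2) by auto
    then obtain l where l: "e l" "l \<noteq> k" using k by auto
    have "\<exists>f. carries (point k \<oplus>\<oplus> point l) f"
    proof (cases "k < l")
      case False
      then have "\<exists>f. carries (point l \<oplus>\<oplus> point k) f" using l(2) carries_two by simp
      moreover have "point l \<oplus>\<oplus> point k = point k \<oplus>\<oplus> point l" by (auto simp: xor_track_def)
      ultimately show ?thesis by simp
    qed (rule carries_two)
    then obtain f where f: "carries (point k \<oplus>\<oplus> point l) f" by blast
    let ?e = "e \<oplus>\<oplus> (point k \<oplus>\<oplus> point l)"
    have s: "{i. ?e i} = {i. e i} - {k, l}" using k l by (auto simp: xor_track_def point_def)
    have two: "card {k, l} = 2" using l(2) by simp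
    have c: "card {i. ?e i} = card {i. e i} - 2" "card {i. e i} \<ge> 2"
      unfolding s using k l fe two card_Diff_subset[of "{k, l}" "{i. e i}"] card_mono[of "{i. e i}" "{k, l}"] by auto
    obtain f' where "carries ?e f'"
      using less.hyps[of ?e] c less.prems by (auto simp: finite_track_xor)
    then have "carries (?e \<oplus>\<oplus> (point k \<oplus>\<oplus> point l)) (\<lambda>t. f' t \<oplus>\<oplus> f t)" using f by (rule carries_xor)
    then show ?thesis by auto
  qed
qed

text \<open>For generic \<open>T\<close>, the only translate of \<open>T j\<close> in the family is
  \<open>T j\<close> itself, with \<open>q = 0\<close>, so \<open>reach_add\<close> with
  \<open>u = T j\<close> acts on index \<open>j\<close> alone.\<close>

lemma reach_add_one:
  assumes I: "finite I" and T: "generic I T" and j: "j \<in> I" and clean: "\<And>k. k \<in> {n - 4..n + 2} \<Longrightarrow> \<not> B j k"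
  shows "reach I T B T (B(j := B j \<oplus>\<oplus> point n))"
proof -
  have eq: "T i = translate q (T j) \<longleftrightarrow> i = j \<and> q = 0" if "i \<in> I" for i q
    using T that j translate_unique[of "T j" q 0] unfolding generic_def by (metis translate_0)
  have "reach I T B T (\<lambda>i k. B i k \<noteq> (T i = translate (k - n) (T j)))"
  proof (rule reach_add[OF I])
    fix i q k assume "i \<in> I" "T i = translate q (T j)" "k \<in> {n + q - 4..n + q + 2}"
    then show "\<not> B i k" using eq clean by auto
  qed (use T j in \<open>auto simp: generic_def\<close>)
  moreover have "reach I T (\<lambda>i k. B i k \<noteq> (T i = translate (k - n) (T j))) T (B(j := B j \<oplus>\<oplus> point n))"
    by (rule reach_refl) (auto simp: eq xor_track_def point_def)
  ultimately show ?thesis by (rule reach_trans)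
qed

text \<open>
  The far bit on \<open>T j\<close> must be removed while the second track is altered, so the intermediate family
  \<open>?B2\<close> has to stay generic; this is why the gate translates by \<open>m\<close> with \<open>m\<close> large.
\<close>

lemma reach_change_even:
  assumes I: "finite I" and T: "\<And>i. i \<in> I \<Longrightarrow> finite_track (T i)" and B: "generic I B" and j: "j \<in> I"
    and B': "generic I (B(j := b))" and even: "even (card {k. (B j \<oplus>\<oplus> b) k})"
  shows "reach I T B T (B(j := b))"
proof -
  have "finite_track (B j)" "finite_track b" using B B' j by (auto simp: generic_def)
  then obtain f where f: "carries (B j \<oplus>\<oplus> b) f" using carries_even[OF finite_track_xor even] by blast
  let ?B' = "B(j := b)"
  have "\<forall>\<^sub>F m in at_top. f (T j \<oplus>\<oplus> point (- m)) = f (T j) \<oplus>\<oplus> translate (- m) (B j \<oplus>\<oplus> b)"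
    using f T[OF j] by (auto simp: carries_def)
  moreover have "\<forall>\<^sub>F m in at_top. generic I (\<lambda>i. ?B' i \<oplus>\<oplus> translate m (f (T i)))"
    using f T by (intro eventually_generic[OF I B']) (auto simp: carries_def)
  moreover have "\<forall>\<^sub>F m in at_top. \<forall>k\<le>2 - m. \<not> T j k"
    using T[OF j] by (rule far_left)
  ultimately have "\<forall>\<^sub>F m in at_top. f (T j \<oplus>\<oplus> point (- m)) = f (T j) \<oplus>\<oplus> translate (- m) (B j \<oplus>\<oplus> b) \<and>
    generic I (\<lambda>i. ?B' i \<oplus>\<oplus> translate m (f (T i))) \<and> (\<forall>k\<le>2 - m. \<not> T j k)"
    by eventually_elim blast
  then obtain m where far: "f (T j \<oplus>\<oplus> point (- m)) = f (T j) \<oplus>\<oplus> translate (- m) (B j \<oplus>\<oplus> b)"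
    and gen: "generic I (\<lambda>i. ?B' i \<oplus>\<oplus> translate m (f (T i)))" and clean: "\<forall>k\<le>2 - m. \<not> T j k"
    using eventually_at_top_int_ex by blast
  have gate: "reach I S A S (\<lambda>i. A i \<oplus>\<oplus> translate m (f (S i)))" for S A
    unfolding reach_def using f
    by (intro bexI[of _ "\<lambda>(t, b). (t, b \<oplus>\<oplus> translate m (f t))"]) (auto simp: carries_def)
  let ?T1 = "T(j := T j \<oplus>\<oplus> point (- m))" and ?B2 = "\<lambda>i. ?B' i \<oplus>\<oplus> translate m (f (T i))"
  have add: "reach I T A ?T1 A" if "generic I A" for A
  proof -
    \<comment> \<open>With the tracks exchanged, the generic family \<open>A\<close> singles out
      index \<open>j\<close>, and the bit goes to the first track.\<close>
    have "reach I A T A ?T1" by (rule reach_add_one[OF I that j]) (use clean in auto)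
    then show ?thesis using reach_swap by blast
  qed
  have "reach I T B ?T1 B" by (rule add[OF B])
  also have "reach I ?T1 B ?T1 (\<lambda>i. B i \<oplus>\<oplus> translate m (f (?T1 i)))" by (rule gate)
  \<comment> \<open>The offset \<open>m\<close> cancels the position \<open>-m\<close> of the far
    bit, so index \<open>j\<close> receives \<open>B j \<oplus>\<oplus> b\<close> besides the term
    \<open>translate m (f (T i))\<close> that every index receives. The last gate removes these
    terms.\<close>
  also have "reach I ?T1 (\<lambda>i. B i \<oplus>\<oplus> translate m (f (?T1 i))) ?T1 ?B2"
  proof (rule reach_refl)
    show "?T1 i = ?T1 i \<and> B i \<oplus>\<oplus> translate m (f (?T1 i)) = ?B2 i" for i
      by (cases "i = j") (auto simp: far translate_xor, auto simp: xor_track_def)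
  qed
  also have "reach I ?T1 ?B2 T ?B2" by (rule reach_sym[OF add[OF gen]])
  also have "reach I T ?B2 T ?B'" by (rule reach_sym[OF gate])
  finally show ?thesis .
qed

section \<open>Transitivity\<close>

lemma reach_change:
  assumes I: "finite I" and T: "generic I T" and B: "generic I B" and j: "j \<in> I"
    and B': "generic I (B(j := b))"
  shows "reach I T B T (B(j := b))"
proof (cases "even (card {k. (B j \<oplus>\<oplus> b) k})")
  case True
  then show ?thesis using T by (intro reach_change_even I B j B') (auto simp: generic_def)
next
  case False
  have f: "finite_track (B j)" "finite_track (B j \<oplus>\<oplus> b)" using B B' j by (auto simp: generic_def finite_track_xor)
  \<comment> \<open>Writes the update at \<open>j\<close> as a family translated by
    \<open>n\<close>, the form to which \<open>eventually_generic\<close> applies.\<close>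
  let ?F = "\<lambda>i. if i = j then point 0 else (\<lambda>_. False)"
  have "finite_track (?F i)" for i by (auto simp: finite_track_def point_def)
  then have "\<forall>\<^sub>F n in at_top. generic I (\<lambda>i. B i \<oplus>\<oplus> translate n (?F i))"
    by (intro eventually_generic I B)
  moreover have "\<forall>\<^sub>F n in at_top. \<forall>k\<ge>n - 4. \<not> B j k" "\<forall>\<^sub>F n in at_top. \<forall>k\<ge>n - 0. \<not> (B j \<oplus>\<oplus> b) k"
    by (rule far_right[OF f(1)], rule far_right[OF f(2)])
  ultimately have "\<forall>\<^sub>F n in at_top. generic I (\<lambda>i. B i \<oplus>\<oplus> translate n (?F i)) \<and> (\<forall>k\<ge>n - 4. \<not> B j k) \<and>
      (\<forall>k\<ge>n - 0. \<not> (B j \<oplus>\<oplus> b) k)"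
    by eventually_elim blast
  then obtain n where n: "generic I (\<lambda>i. B i \<oplus>\<oplus> translate n (?F i))" "\<forall>k\<ge>n - 4. \<not> B j k" "\<not> (B j \<oplus>\<oplus> b) n"
    using eventually_at_top_int_ex by fastforce
  let ?B1 = "B(j := B j \<oplus>\<oplus> point n)"
  have "(\<lambda>i. B i \<oplus>\<oplus> translate n (?F i)) = ?B1"
    by (auto simp: fun_eq_iff xor_track_def translate_def point_def)
  then have g: "generic I ?B1" using n(1) by simp
  have "reach I T B T ?B1"
    by (rule reach_add_one[OF I T j]) (use n(2) in auto)
  moreover have "reach I T ?B1 T (?B1(j := b))"
  proof (rule reach_change_even[OF I _ g j])
    \<comment> \<open>The new bit lies where \<open>B j\<close> and \<open>b\<close> agree, so it
      changes the parity of their difference.\<close>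
    have "{k. (?B1 j \<oplus>\<oplus> b) k} = insert n {k. (B j \<oplus>\<oplus> b) k}"
      using n(3) by (auto simp: xor_track_def point_def)
    moreover have "card (insert n {k. (B j \<oplus>\<oplus> b) k}) = Suc (card {k. (B j \<oplus>\<oplus> b) k})"
      using f(2) n(3) by (simp add: finite_track_def)
    ultimately show "even (card {k. (?B1 j \<oplus>\<oplus> b) k})" using False by simp
  qed (use T B' in \<open>auto simp: generic_def\<close>)
  ultimately have "reach I T B T (?B1(j := b))" by (rule reach_trans)
  then show ?thesis by simp
qed

text \<open>Tracks are replaced one index at a time. Freshness of \<open>C\<close> keeps every
  mixture of old and new tracks generic, as \<open>reach_change\<close> requires.\<close>

lemma reach_replace:
  assumes I: "finite I" and T: "generic I T" and B: "generic I B" and C: "generic I C"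
    and fresh: "\<And>i l q. i \<in> I \<Longrightarrow> l \<in> I \<Longrightarrow> B l \<noteq> translate q (C i)"
  shows "reach I T B T C"
proof -
  have fresh': "C i \<noteq> translate q (B l)" if "i \<in> I" "l \<in> I" for i l q
  proof
    assume "C i = translate q (B l)"
    then have "B l = translate (- q) (C i)" by simp
    then show False using fresh that by blast
  qed
  have mixed: "generic I (\<lambda>i. if i \<in> J then C i else B i)" for J
    using B C fresh fresh' unfolding generic_def by auto
  have "reach I T B T (\<lambda>i. if i \<in> J then C i else B i)" if "finite J" "J \<subseteq> I" for J
    using that
  proof (induction J)
    case empty
    show ?case by (rule reach_refl) simp
  next
    case (insert j J)
    have e: "(\<lambda>i. if i \<in> insert j J then C i else B i) = (\<lambda>i. if i \<in> J then C i else B i)(j := C j)"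
      by auto
    have "j \<in> I" "J \<subseteq> I" using insert.prems by auto
    have step: "reach I T (\<lambda>i. if i \<in> J then C i else B i) T ((\<lambda>i. if i \<in> J then C i else B i)(j := C j))"
      by (rule reach_change[OF I T mixed \<open>j \<in> I\<close>]) (rule mixed[of "insert j J", unfolded e])
    show ?case unfolding e by (rule reach_trans[OF insert.IH[OF \<open>J \<subseteq> I\<close>] step])
  qed
  from this[OF I] have "reach I T B T (\<lambda>i. if i \<in> I then C i else B i)" by simp
  also have "reach I T (\<lambda>i. if i \<in> I then C i else B i) T C" by (rule reach_refl) simp
  finally show ?thesis .
qed

lemma exists_fresh:
  fixes I :: "nat set"
  assumes "finite S" "\<And>s. s \<in> S \<Longrightarrow> finite_track s"
  shows "\<exists>C. generic I C \<and> (\<forall>s\<in>S. \<forall>i. \<forall>q. s \<noteq> translate q (C i))"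
proof -
  have "finite_track (\<lambda>k. \<exists>s\<in>S. s k)"
  proof -
    have "{k. \<exists>s\<in>S. s k} = (\<Union>s\<in>S. {k. s k})" by auto
    then show ?thesis using assms by (auto simp: finite_track_def)
  qed
  then obtain R where R: "\<And>s k. s \<in> S \<Longrightarrow> s k \<Longrightarrow> \<bar>k\<bar> \<le> R" using finite_track_bound by blast
  \<comment> \<open>Two ones at a distance that exceeds the diameter of every track in
    \<open>S\<close> and determines \<open>i\<close>.\<close>
  define C where "C = (\<lambda>i :: nat. \<lambda>k. k = 0 \<or> k = 2 * \<bar>R\<bar> + 1 + int i)"
  have "generic I C"
    unfolding generic_def
  proof (intro conjI ballI impI allI notI)
    show "finite_track (C i)" "nonzero_track (C i)" for i by (auto simp: finite_track_def nonzero_track_def C_def)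
    fix i l q assume "i \<noteq> l" and eq: "C l = translate q (C i)"
    have e: "C l k = C i (k - q)" for k using eq by (simp add: translate_def)
    \<comment> \<open>The ones of \<open>C i\<close> and \<open>C l\<close> at 0 force
      \<open>q = 0\<close>; then the second ones must coincide, which contradicts
      \<open>i \<noteq> l\<close>.\<close>
    have "C l q" "C l (q + 2 * \<bar>R\<bar> + 1 + int i)" "C i (- q)"
      unfolding e[of q] e[of "q + 2 * \<bar>R\<bar> + 1 + int i"] using e[of 0] by (auto simp: C_def)
    then show False using \<open>i \<noteq> l\<close> by (auto simp: C_def)
  qed
  moreover have "s \<noteq> translate q (C i)" if "s \<in> S" for s q i
  proof
    assume "s = translate q (C i)"
    then have "s q" "s (q + 2 * \<bar>R\<bar> + 1 + int i)" by (simp_all add: translate_def C_def)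
    then show False using R[OF that, of q] R[OF that, of "q + 2 * \<bar>R\<bar> + 1 + int i"] by auto
  qed
  ultimately show ?thesis by blast
qed

text \<open>Both families are made generic and then led to the common target with \<open>C\<close>
  on both tracks, where \<open>C\<close> is fresh for all the tracks involved; reversibility joins
  the two routes.\<close>

lemma reach_all:
  fixes I :: "nat set"
  assumes I: "finite I"
    and X: "\<And>i. i \<in> I \<Longrightarrow> finite_track (T i) \<and> finite_track (B i) \<and> (nonzero_track (T i) \<or> nonzero_track (B i))" "pairwise_inequiv I T B"
    and Y: "\<And>i. i \<in> I \<Longrightarrow> finite_track (T' i) \<and> finite_track (B' i) \<and> (nonzero_track (T' i) \<or> nonzero_track (B' i))" "pairwise_inequiv I T' B'"
  shows "reach I T B T' B'"
proof -
  have "\<exists>T1 B1. reach I T B T1 B1 \<and> generic I T1 \<and> generic I B1"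
    by (rule make_generic_pair[OF I _ _ X(2)]) (use X(1) in auto)
  then obtain T1 B1 where X1: "reach I T B T1 B1" "generic I T1" "generic I B1" by blast
  have "\<exists>T2 B2. reach I T' B' T2 B2 \<and> generic I T2 \<and> generic I B2"
    by (rule make_generic_pair[OF I _ _ Y(2)]) (use Y(1) in auto)
  then obtain T2 B2 where Y1: "reach I T' B' T2 B2" "generic I T2" "generic I B2" by blast
  let ?S = "T1 ` I \<union> B1 ` I \<union> T2 ` I \<union> B2 ` I"
  have "\<exists>C. generic I C \<and> (\<forall>s\<in>?S. \<forall>i. \<forall>q. s \<noteq> translate q (C i))"
    by (rule exists_fresh) (use I X1 Y1 in \<open>auto simp: generic_def\<close>)
  then obtain C where C: "generic I C" "\<forall>s\<in>?S. \<forall>i q. s \<noteq> translate q (C i)" by blast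
  have "reach I T B T1 B1" by (rule X1)
  also have "reach I T1 B1 T1 C" by (rule reach_replace[OF I X1(2,3) C(1)]) (use C(2) in blast)
  also have "reach I T1 C C C"
    by (subst reach_swap, rule reach_replace[OF I C(1) X1(2) C(1)]) (use C(2) in blast)
  also have "reach I C C T2 C"
    by (rule reach_sym, subst reach_swap, rule reach_replace[OF I C(1) Y1(2) C(1)]) (use C(2) in blast)
  also have "reach I T2 C T2 B2"
    by (rule reach_sym, rule reach_replace[OF I Y1(2,3) C(1)]) (use C(2) in blast)
  also have "reach I T2 B2 T' B'" by (rule reach_sym[OF Y1(1)])
  finally show ?thesis .
qed

section \<open>Back to configurations and shift orbits\<close>

lemma automorphism_nonzero_finite:
  assumes "automorphism g" "automorphism g'" "g' \<circ> g = id" "x \<in> nonzero_finite_points"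
  shows "lift g x \<in> nonzero_finite_points"
proof -
  have x: "finite_pair (dec x)" "dec x \<noteq> zero_pair"
    using assms(4) enc_nonzero_finite_iff[of "dec x"] by (auto simp: nonzero_pair_iff)
  \<comment> \<open>The inverse fixes \<open>zero_pair\<close> as well, so no other pair is sent
    there.\<close>
  have "g (dec x) \<noteq> zero_pair"
  proof
    assume "g (dec x) = zero_pair"
    then have "g' (g (dec x)) = zero_pair" using assms(2) by (simp add: automorphism_def)
    then show False using x assms(3) by (simp add: pointfree_idE)
  qed
  then show ?thesis using x assms(1) by (simp add: lift_def enc_nonzero_finite_iff nonzero_pair_iff automorphism_def del: split_paired_All)
qed

lemma generate_preserves:
  assumes "h \<in> generate Aut (lift ` gates)" "x \<in> nonzero_finite_points"
  shows "h x \<in> nonzero_finite_points"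
  using assms
proof (induction arbitrary: x rule: generate.induct)
  case one
  then show ?case by simp
next
  case (incl h)
  then obtain g where g: "h = lift g" "g \<in> gates" by blast
  then show ?case using automorphism_nonzero_finite[of g] involutive_commutator_lift(3,4)[OF involutive_commutator_gates[OF g(2)]] incl by blast
next
  case (inv h)
  then obtain g where g: "h = lift g" "g \<in> gates" by blast
  then obtain g' where g': "automorphism g" "automorphism g'" "g \<circ> g' = id" "g' \<circ> g = id"
    using involutive_commutator_lift(3,4)[OF involutive_commutator_gates[OF g(2)]] by blast
  then have "inv\<^bsub>Aut\<^esub> h = lift g'"
    unfolding g(1) by (intro inv_Aut) (simp_all add: automorphism_def flip: lift_comp)
  then show ?case using automorphism_nonzero_finite[of g' g] g' inv by simp
next
  case (eng h1 h2)
  then show ?case by simp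
qed

lemma shift_orbit_enc: "shift_orbit (enc x) = {enc (translate_pair q x) | q. True}"
proof -
  have "(shift [^]\<^bsub>Aut\<^esub> n) (enc x) = enc (translate_pair (- n) x)" for n :: int
    by (simp add: shift_int_pow enc_def translate_pair_def translate_def)
  then show ?thesis unfolding shift_orbit_def by (metis minus_minus)
qed

lemma translate_pair_translate_pair: "translate_pair p (translate_pair q x) = translate_pair (p + q) x"
  by (simp add: translate_pair_def)

lemma shift_orbit_translate_pair: "shift_orbit (enc (translate_pair p x)) = shift_orbit (enc x)"
proof -
  have "(\<exists>q. y = enc (translate_pair (q + p) x)) \<longleftrightarrow> (\<exists>q. y = enc (translate_pair q x))" for y
    by (metis diff_add_cancel)
  then show ?thesis unfolding shift_orbit_enc translate_pair_translate_pair by simp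
qed

text \<open>Pairs that are translates of each other encode configurations with the same shift
  orbit.\<close>

lemma orbits_pairwise_inequiv:
  assumes "\<forall>i\<in>I. \<forall>j\<in>I. i \<noteq> j \<longrightarrow> shift_orbit (x i) \<noteq> shift_orbit (x j)"
  shows "pairwise_inequiv I (\<lambda>i. fst (dec (x i))) (\<lambda>i. snd (dec (x i)))"
  unfolding pairwise_inequiv_def
proof (intro ballI impI allI notI)
  fix i l q assume il: "i \<in> I" "l \<in> I" "i \<noteq> l"
    and "fst (dec (x l)) = translate q (fst (dec (x i))) \<and> snd (dec (x l)) = translate q (snd (dec (x i)))"
  then have "dec (x l) = translate_pair q (dec (x i))" by (simp add: translate_pair_def prod_eq_iff)
  then have "x l = enc (translate_pair q (dec (x i)))" by (metis enc_dec)
  then have "shift_orbit (x l) = shift_orbit (x i)" using shift_orbit_translate_pair[of q "dec (x i)"] by simp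
  then show False using assms il by metis
qed

theorem theorem2p3:
  shows "\<exists>F :: (4 config \<Rightarrow> 4 config) set.
    F \<subseteq> carrier Aut \<and> finite F \<and>
    (\<forall>f\<in>F. (\<exists>a\<in>carrier Aut. \<exists>b\<in>carrier Aut. f = commutator Aut a b) \<and>
            (\<exists>hs. set hs \<subseteq> involutions Aut \<and> f = foldr (\<otimes>\<^bsub>Aut\<^esub>) hs \<one>\<^bsub>Aut\<^esub>)) \<and>
    inf_orbit_transitive (generate Aut F) nonzero_finite_points"
proof (intro exI[of _ "lift ` gates"] conjI)
  show "lift ` gates \<subseteq> carrier Aut"
    using involutive_commutator_lift(3)[OF involutive_commutator_gates] by (auto simp: automorphism_def)
  show "finite (lift ` gates)" by (simp add: gates_def base_gates_def)
  show "\<forall>f\<in>lift ` gates. (\<exists>a\<in>carrier Aut. \<exists>b\<in>carrier Aut. f = commutator Aut a b) \<and>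
            (\<exists>hs. set hs \<subseteq> involutions Aut \<and> f = foldr (\<otimes>\<^bsub>Aut\<^esub>) hs \<one>\<^bsub>Aut\<^esub>)"
    using involutive_commutator_lift(1,2)[OF involutive_commutator_gates] by blast
  show "inf_orbit_transitive (generate Aut (lift ` gates)) nonzero_finite_points"
    unfolding inf_orbit_transitive_def
  proof (intro conjI ballI allI impI)
    show "g ` nonzero_finite_points \<subseteq> nonzero_finite_points" if "g \<in> generate Aut (lift ` gates)" for g
      using generate_preserves[OF that] by blast
    fix k :: nat and x y :: "nat \<Rightarrow> 4 config"
    let ?I = "{1..k}"
    assume xy: "\<forall>i\<in>?I. x i \<in> nonzero_finite_points \<and> y i \<in> nonzero_finite_points"
      and x: "\<forall>i\<in>?I. \<forall>j\<in>?I. i \<noteq> j \<longrightarrow> shift_orbit (x i) \<noteq> shift_orbit (x j)"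
      and y: "\<forall>i\<in>?I. \<forall>j\<in>?I. i \<noteq> j \<longrightarrow> shift_orbit (y i) \<noteq> shift_orbit (y j)"
    have fn: "finite_track (fst (dec z)) \<and> finite_track (snd (dec z)) \<and> (nonzero_track (fst (dec z)) \<or> nonzero_track (snd (dec z)))"
      if "z \<in> nonzero_finite_points" for z
      using that enc_nonzero_finite_iff[of "dec z"] by (simp add: finite_pair_def nonzero_pair_def)
    have "reach ?I (\<lambda>i. fst (dec (x i))) (\<lambda>i. snd (dec (x i))) (\<lambda>i. fst (dec (y i))) (\<lambda>i. snd (dec (y i)))"
      by (rule reach_all) (use xy fn orbits_pairwise_inequiv[OF x] orbits_pairwise_inequiv[OF y] in auto)
    then obtain g where g: "g \<in> gate_group" "\<forall>i\<in>?I. g (dec (x i)) = dec (y i)"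
      unfolding reach_def by auto
    then have "lift g (x i) = y i" if "i \<in> ?I" for i
      using that by (simp add: lift_def)
    then show "\<exists>g\<in>generate Aut (lift ` gates). \<forall>i\<in>?I. g (x i) = y i"
      using lift_gate_group[OF g(1)] by blast
  qed
qed

end
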